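(* Let $A$ be a finite set of atoms, let $\ell, r$ be hedges or individual terms and $\nabla$ a freshness context, all $A$-based, and let $X$ be a hedge variable occurring neither in $\ell$, $r$ nor $\nabla$. If $G$ is an $A$-based generalization of $\langle\nabla\vdash\ell\rangle$ and $\langle\nabla\vdash r\rangle$, then there exists a derivation $\{X\colon \ell\triangleq r\};\,\emptyset;\,\emptyset;\,id\overset{+}{\Longrightarrow}\emptyset;\,S;\,\Gamma;\,\sigma$ obtained by an execution of the algorithm $\mathsf{VNAU}$ with global parameters $A$ and $\nabla$, such that $G$ is more general than $\langle\Gamma\vdash X\sigma\rangle$.
   Context: Signature: four pairwise disjoint sets: a countably infinite set of atoms $\mathbf{A}=\{a,b,c,\dots\}$, a countable set of variadic function symbols $\{f,g,h,\dots\}$, a countably infinite set of individual variables $\{x,y,z,\dots\}$ and a countably infinite set of hedge variables $\{X,Y,Z,\dots\}$; $\chi$ denotes a variable of either kind. Permutations $\pi$ of atoms have finite support $\mathrm{supp}(\pi)=\{a\mid \pi(a)\neq a\}$ and are written as finite sequences of swappings $(a\,b)$; $\mathit{Id}$ is the identity. Terms are individual terms $t::= a \mid \pi\cdot x \mid a.t \mid f(\tilde s)$, and hedges $\tilde s ::= r_1,\dots,r_n$ ($n\ge 0$) with $r::=\pi\cdot X\mid t$. Hedges are flat, a singleton hedge is identified with its element, $\varepsilon$ is the empty hedge, $|\tilde s|$ is the length. $\pi\cdot x$, $\pi\cdot X$ are suspensions; $\chi$ abbreviates $\mathit{Id}\cdot\chi$. Permutations act on terms: $(a\,b)\cdot a=b$,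 $(a\,b)\cdot b=a$, $(a\,b)\cdot c=c$ for $c\notin\{a,b\}$, $(a\,b)\cdot(\pi\cdot\chi)=((a\,b)\pi)\cdot\chi$, $(a\,b)\cdot(c.t)=((a\,b)\cdot c).((a\,b)\cdot t)$, $(a\,b)\cdot f(\tilde s)=f((a\,b)\cdot\tilde s)$, componentwise on hedges; a sequence of swappings acts from right to left. Heads: $\mathrm{head}(a)=a$, $\mathrm{head}(\pi\cdot\chi)=\chi$, $\mathrm{head}(a.t)=\text{``.''}$, $\mathrm{head}(f(\tilde s))=f$. Substitutions are finite maps from variables to terms (individual variables to individual terms), identity elsewhere; $id$ is the empty substitution; application: $a\sigma=a$, $(\pi\cdot\chi)\sigma=\pi\cdot(\chi\sigma)$, $(a.t)\sigma=a.(t\sigma)$, $f(\tilde s)\sigma=f(\tilde s\sigma)$, componentwise on hedges. $\sigma\{\chi\mapsto u\}$ is composition of $\sigma$ followed by $\{\chi\mapsto u\}$. A freshness context is a finite set of constraints $a\#\chi$. $\nabla\vdash a\# u$: $\nabla\vdash a\#b$ if $a\ne b$; $\nabla\vdash a\#f(\tilde s)$ if $\nabla\vdash a\#\tilde s$; $\nabla\vdash a\#(r_1,\dots,r_n)$ if $\nabla\vdash a\#r_i$ for all $i$; $\nabla\vdash a\#a.t$; $\nabla\vdash a\#b.t$ if $a\neq b$ and $\nabla\vdash a\#t$; $\nabla\vdash a\#\pi\cdot\chi$ if $(\pi^{-1}\cdot a)\#\chi\in\nabla$. A substitution $\sigma$ respects $\nabla$ if $\nabla\vdash a\#\chi\sigma$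 for all $a\#\chi\in\nabla$; then $\nabla\sigma$ is the smallest freshness context $\Gamma$ with $\Gamma\vdash a\#\chi\sigma$ for all $a\#\chi\in\nabla$ (also written $\Gamma\{\chi\mapsto u\}$ for a single assignment). The equivalence $\nabla\vdash u\approx u'$: $a\approx a$; $f(\tilde s)\approx f(\tilde q)$ if $\tilde s\approx\tilde q$; hedges of equal length componentwise; $a.t\approx a.t'$ if $t\approx t'$; $a.t\approx b.t'$ if $t\approx (a\,b)\cdot t'$ and $\nabla\vdash a\#b.t'$; $\pi\cdot\chi\approx\pi'\cdot\chi$ if $a\#\chi\in\nabla$ for all $a$ with $\pi\cdot a\neq\pi'\cdot a$. A term-in-context is a pair $\langle\nabla\vdash u\rangle$. $\langle\nabla_1\vdash u_1\rangle$ is more general than $\langle\nabla_2\vdash u_2\rangle$ if there is a substitution $\sigma$ respecting $\nabla_1$ with $\nabla_1\sigma\subseteq\nabla_2$ and $\nabla_2\vdash u_1\sigma\approx u_2$. A generalization of two terms-in-context is a term-in-context more general than both. Something is $A$-based if all atoms occurring in it (including supports of permutations in suspensions, atoms in freshness constraints) belong to $A$. The algorithm $\mathsf{VNAU}$ (global parameters: finite $A\subset\mathbf{A}$ and freshness context $\nabla$) works on states $P;\,S;\,\Gamma;\,\sigma$ with $P$, $S$ sets of anti-unification problems (AUPs) $\chi\colon \ell\triangleq r$, $\Gamma$ a freshness context, $\sigma$ a substitution; it applies the following rules exhaustively in all possible ways (branching over all choices). "New" variables occur neither in the state nor in the parameters; $\dot\cup$ is disjoint union. Rules: (Tri-T)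 $\{X\colon a\triangleq a\}\dot\cup P;S;\Gamma;\sigma \Rightarrow P;S;\Gamma;\sigma\{X\mapsto a\}$. (Tri-H) $\{X\colon \varepsilon\triangleq\varepsilon\}\dot\cup P;S;\Gamma;\sigma\Rightarrow P;S;\Gamma;\sigma\{X\mapsto\varepsilon\}$. (Dec-T) $\{X\colon f(\tilde s)\triangleq f(\tilde q)\}\dot\cup P;S;\Gamma;\sigma\Rightarrow\{Y\colon\tilde s\triangleq\tilde q\}\cup P;S;\Gamma;\sigma\{X\mapsto f(Y)\}$, $Y$ a new hedge variable. (Dec-H) $\{X\colon \tilde s_1,\tilde s_2\triangleq\tilde q_1,\tilde q_2\}\dot\cup P;S;\Gamma;\sigma\Rightarrow\{Y_1\colon\tilde s_1\triangleq\tilde q_1, Y_2\colon\tilde s_2\triangleq\tilde q_2\}\cup P;S;\Gamma;\sigma\{X\mapsto Y_1,Y_2\}$, where $|\tilde s_1,\tilde q_1|=1$ or $|\tilde s_1|=|\tilde q_1|=1$, $|\tilde s_2,\tilde q_2|\ge 1$, $Y_1,Y_2$ new hedge variables. (Abs-T) $\{X\colon a.t_1\triangleq b.t_2\}\dot\cup P;S;\Gamma;\sigma\Rightarrow\{Y\colon (c\,a)\cdot t_1\triangleq (c\,b)\cdot t_2\}\cup P;S;\Gamma;\sigma\{X\mapsto c.Y\}$, where $c\in A$, $Y$ new hedge variable, $\nabla\vdash c\#a.t_1$ and $\nabla\vdash c\#b.t_2$. (Sol-T) $\{X\colon r_1\triangleq r_2\}\dot\cup P;S;\Gamma;\sigma\Rightarrow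 P;\{X\colon r_1\triangleq r_2\}\cup S;\{a\#X\mid a\in A,\nabla\vdash a\#r_1,\nabla\vdash a\#r_2\}\cup\Gamma;\sigma$, where $r_1,r_2$ are suspensions or $\mathrm{head}(r_1)\ne\mathrm{head}(r_2)$. (Sol-H) $\{X\colon \tilde s\triangleq\tilde q\}\dot\cup P;S;\Gamma;\sigma\Rightarrow P;\{X\colon\tilde s\triangleq\tilde q\}\cup S;\{a\#X\mid a\in A,\nabla\vdash a\#\tilde s,\nabla\vdash a\#\tilde q\}\cup\Gamma;\sigma$, where $|\tilde s,\tilde q|=1$. (Mer) $P;\{\chi_1\colon\ell_1\triangleq r_1,\chi_2\colon\ell_2\triangleq r_2\}\dot\cup S;\Gamma;\sigma\Rightarrow P;\{\chi_1\colon\ell_1\triangleq r_1\}\cup S;\Gamma\{\chi_2\mapsto\pi\cdot\chi_1\};\sigma\{\chi_2\mapsto\pi\cdot\chi_1\}$, where $\pi$ is an $A$-based permutation with $\nabla\vdash\pi\cdot\ell_1\approx\ell_2$ and $\nabla\vdash\pi\cdot r_1\approx r_2$. (Nar-T) $P;\{X\colon t_1\triangleq t_2\}\dot\cup S;\Gamma;\sigma\Rightarrow P;\{x\colon t_1\triangleq t_2\}\cup S;\Gamma\{X\mapsto x\};\sigma\{X\mapsto x\}$ ($t_1,t_2$ individual terms, $x$ new individual variable).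
   Formalization: The claim is false as printed: Sol-T is extended to also store a.t1 ≜ b.t2 when no c in A makes Abs-T applicable, and "σ respects ∇" is read as: some freshness context derives a#χσ for all a#χ in ∇. Mer never maps an individual variable to a suspended hedge variable. *)

theory Defs
  imports "HOL-Combinatorics.Perm" "HOL-Library.Countable"
begin

unbundle permutation_syntax

section \<open>Signature and syntax\<close>

datatype atom = Atm nat
datatype ivar = IVar nat
datatype hvar = HVar nat

datatype var = IV ivar | HV hvar

text \<open>
  A hedge is a list of elements, so hedges are flat, and an individual term is identified with the
  one-element list containing it. Permutations of atoms are the finitely supported bijections of
  \<^typ>\<open>atom perm\<close> (every one of them is a product of swappings), and \<^const>\<open>affected\<close> is the support.

  The grammar allows only an individual term under an abstraction, yet the abstraction
  rule of the algorithm introduces the expression \<open>c.Y\<close> with \<open>Y\<close> a hedge variable (to be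
  replaced by an individual variable or an individual term later). The datatype therefore admits an
  arbitrary hedge under an abstraction; \<open>wf_elem\<close> and \<open>wf_hedge\<close> below single out the
  expressions generated by the grammar. The operations on raw expressions agree with the
  intended ones on well-formed expressions.
\<close>

datatype 'f elem =
    Atom atom
  | Susp "atom perm" var
  | Abs atom "'f elem list"
  | Fun 'f "'f elem list"

type_synonym 'f hedge = "'f elem list"

fun is_hsusp :: "'f elem \<Rightarrow> bool" where
  "is_hsusp (Susp \<pi> (HV X)) \<longleftrightarrow> True"
| "is_hsusp _ \<longleftrightarrow> False"

fun wf_elem :: "'f elem \<Rightarrow> bool" where
  "wf_elem (Atom a) \<longleftrightarrow> True"
| "wf_elem (Susp \<pi> \<chi>) \<longleftrightarrow> True"
| "wf_elem (Abs a s) \<longleftrightarrow> length s = 1 \<and> (\<forall>t\<in>set s. wf_elem t \<and> \<not> is_hsusp t)"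
| "wf_elem (Fun f s) \<longleftrightarrow> (\<forall>t\<in>set s. wf_elem t)"

definition wf_hedge :: "'f hedge \<Rightarrow> bool" where
  "wf_hedge s \<longleftrightarrow> (\<forall>t\<in>set s. wf_elem t)"

definition wf_iterm :: "'f elem \<Rightarrow> bool" where
  "wf_iterm t \<longleftrightarrow> wf_elem t \<and> \<not> is_hsusp t"

datatype 'f head_sym = HdAtom atom | HdVar var | HdAbs | HdFun 'f

fun head :: "'f elem \<Rightarrow> 'f head_sym" where
  "head (Atom a) = HdAtom a"
| "head (Susp \<pi> \<chi>) = HdVar \<chi>"
| "head (Abs a s) = HdAbs"
| "head (Fun f s) = HdFun f"

fun is_susp :: "'f elem \<Rightarrow> bool" where
  "is_susp (Susp \<pi> \<chi>) \<longleftrightarrow> True"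
| "is_susp _ \<longleftrightarrow> False"

fun vars_elem :: "'f elem \<Rightarrow> var set" where
  "vars_elem (Atom a) = {}"
| "vars_elem (Susp \<pi> \<chi>) = {\<chi>}"
| "vars_elem (Abs a s) = (\<Union>t\<in>set s. vars_elem t)"
| "vars_elem (Fun f s) = (\<Union>t\<in>set s. vars_elem t)"

definition vars_hedge :: "'f hedge \<Rightarrow> var set" where
  "vars_hedge s = (\<Union>t\<in>set s. vars_elem t)"

fun atoms_elem :: "'f elem \<Rightarrow> atom set" where
  "atoms_elem (Atom a) = {a}"
| "atoms_elem (Susp \<pi> \<chi>) = affected \<pi>"
| "atoms_elem (Abs a s) = {a} \<union> (\<Union>t\<in>set s. atoms_elem t)"
| "atoms_elem (Fun f s) = (\<Union>t\<in>set s. atoms_elem t)"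

definition atoms_hedge :: "'f hedge \<Rightarrow> atom set" where
  "atoms_hedge s = (\<Union>t\<in>set s. atoms_elem t)"

section \<open>Permutation action and substitutions\<close>

fun act :: "atom perm \<Rightarrow> 'f elem \<Rightarrow> 'f elem" where
  "act \<pi> (Atom a) = Atom (\<pi> \<langle>$\<rangle> a)"
| "act \<pi> (Susp \<rho> \<chi>) = Susp (\<pi> * \<rho>) \<chi>"
| "act \<pi> (Abs a s) = Abs (\<pi> \<langle>$\<rangle> a) (map (act \<pi>) s)"
| "act \<pi> (Fun f s) = Fun f (map (act \<pi>) s)"

definition act_hedge :: "atom perm \<Rightarrow> 'f hedge \<Rightarrow> 'f hedge" where
  "act_hedge \<pi> s = map (act \<pi>) s"

type_synonym 'f subst = "var \<Rightarrow> 'f hedge"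

definition id_subst :: "'f subst" where
  "id_subst = (\<lambda>\<chi>. [Susp 1 \<chi>])"

definition dom_subst :: "'f subst \<Rightarrow> var set" where
  "dom_subst \<sigma> = {\<chi>. \<sigma> \<chi> \<noteq> [Susp 1 \<chi>]}"

definition vars_subst :: "'f subst \<Rightarrow> var set" where
  "vars_subst \<sigma> = dom_subst \<sigma> \<union> (\<Union>\<chi>\<in>dom_subst \<sigma>. vars_hedge (\<sigma> \<chi>))"

definition is_subst :: "'f subst \<Rightarrow> bool" where
  "is_subst \<sigma> \<longleftrightarrow> finite (dom_subst \<sigma>) \<and>
     (\<forall>x. \<exists>t. \<sigma> (IV x) = [t] \<and> wf_iterm t) \<and> (\<forall>X. wf_hedge (\<sigma> (HV X)))"

fun subst_elem :: "'f subst \<Rightarrow> 'f elem \<Rightarrow> 'f hedge" where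
  "subst_elem \<sigma> (Atom a) = [Atom a]"
| "subst_elem \<sigma> (Susp \<pi> \<chi>) = act_hedge \<pi> (\<sigma> \<chi>)"
| "subst_elem \<sigma> (Abs a s) = [Abs a (concat (map (subst_elem \<sigma>) s))]"
| "subst_elem \<sigma> (Fun f s) = [Fun f (concat (map (subst_elem \<sigma>) s))]"

definition subst_hedge :: "'f subst \<Rightarrow> 'f hedge \<Rightarrow> 'f hedge" where
  "subst_hedge \<sigma> s = concat (map (subst_elem \<sigma>) s)"

definition single :: "var \<Rightarrow> 'f hedge \<Rightarrow> 'f subst" where
  "single \<chi> u = id_subst(\<chi> := u)"

definition subst_upd :: "'f subst \<Rightarrow> var \<Rightarrow> 'f hedge \<Rightarrow> 'f subst" where
  "subst_upd \<sigma> \<chi> u = (\<lambda>\<chi>'. subst_hedge (single \<chi> u) (\<sigma> \<chi>'))"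

section \<open>Freshness and equivalence\<close>

text \<open>The pair \<open>(a, \<chi>)\<close> stands for the constraint \<open>a # \<chi>\<close>.\<close>

type_synonym ctx = "(atom \<times> var) set"

definition vars_ctx :: "ctx \<Rightarrow> var set" where
  "vars_ctx \<Delta> = snd ` \<Delta>"

definition atoms_ctx :: "ctx \<Rightarrow> atom set" where
  "atoms_ctx \<Delta> = fst ` \<Delta>"

fun fresh :: "ctx \<Rightarrow> atom \<Rightarrow> 'f elem \<Rightarrow> bool" where
  "fresh \<Delta> a (Atom b) \<longleftrightarrow> a \<noteq> b"
| "fresh \<Delta> a (Susp \<pi> \<chi>) \<longleftrightarrow> (inverse \<pi> \<langle>$\<rangle> a, \<chi>) \<in> \<Delta>"
| "fresh \<Delta> a (Abs b s) \<longleftrightarrow> a = b \<or> (\<forall>t\<in>set s. fresh \<Delta> a t)"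
| "fresh \<Delta> a (Fun f s) \<longleftrightarrow> (\<forall>t\<in>set s. fresh \<Delta> a t)"

definition fresh_hedge :: "ctx \<Rightarrow> atom \<Rightarrow> 'f hedge \<Rightarrow> bool" where
  "fresh_hedge \<Delta> a s \<longleftrightarrow> (\<forall>t\<in>set s. fresh \<Delta> a t)"

inductive equiv_elem :: "ctx \<Rightarrow> 'f elem \<Rightarrow> 'f elem \<Rightarrow> bool" for \<Delta> :: ctx where
  equiv_Atom: "equiv_elem \<Delta> (Atom a) (Atom a)"
| equiv_Fun: "list_all2 (equiv_elem \<Delta>) s q \<Longrightarrow> equiv_elem \<Delta> (Fun f s) (Fun f q)"
| equiv_Abs_same: "list_all2 (equiv_elem \<Delta>) s q \<Longrightarrow> equiv_elem \<Delta> (Abs a s) (Abs a q)"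
| equiv_Abs_diff: "list_all2 (equiv_elem \<Delta>) s (act_hedge \<langle>a \<leftrightarrow> b\<rangle> q) \<Longrightarrow> fresh \<Delta> a (Abs b q) \<Longrightarrow>
    equiv_elem \<Delta> (Abs a s) (Abs b q)"
| equiv_Susp: "(\<And>a. \<pi> \<langle>$\<rangle> a \<noteq> \<pi>' \<langle>$\<rangle> a \<Longrightarrow> (a, \<chi>) \<in> \<Delta>) \<Longrightarrow>
    equiv_elem \<Delta> (Susp \<pi> \<chi>) (Susp \<pi>' \<chi>)"
monos list.rel_mono_strong

definition equiv_hedge :: "ctx \<Rightarrow> 'f hedge \<Rightarrow> 'f hedge \<Rightarrow> bool" where
  "equiv_hedge \<Delta> s q \<longleftrightarrow> list_all2 (equiv_elem \<Delta>) s q"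

text \<open>
  \<open>ctx_instance_of \<Delta> \<sigma> \<Gamma>\<close> says that \<open>\<Gamma>\<close> derives all \<open>a # \<chi>\<sigma>\<close> with \<open>a # \<chi>\<close> in \<open>\<Delta>\<close>.
  A substitution respects \<open>\<Delta>\<close> if these constraints are derivable from some freshness context,
  i.e. if the instance \<open>\<Delta>\<sigma>\<close> exists. (Requiring derivability from \<open>\<Delta>\<close> itself
  would make \<open>\<langle>{a # X} \<turnstile> X\<rangle>\<close> incomparable with its renaming \<open>\<langle>{a # Y} \<turnstile> Y\<rangle>\<close>.)
\<close>

definition ctx_instance_of :: "ctx \<Rightarrow> 'f subst \<Rightarrow> ctx \<Rightarrow> bool" where
  "ctx_instance_of \<Delta> \<sigma> \<Gamma> \<longleftrightarrow> finite \<Gamma> \<and> (\<forall>(a, \<chi>)\<in>\<Delta>. fresh_hedge \<Gamma> a (\<sigma> \<chi>))"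

definition respects_ctx :: "'f subst \<Rightarrow> ctx \<Rightarrow> bool" where
  "respects_ctx \<sigma> \<Delta> \<longleftrightarrow> (\<exists>\<Gamma>. ctx_instance_of \<Delta> \<sigma> \<Gamma>)"

definition ctx_subst :: "ctx \<Rightarrow> 'f subst \<Rightarrow> ctx" where
  "ctx_subst \<Delta> \<sigma> = (LEAST \<Gamma>. ctx_instance_of \<Delta> \<sigma> \<Gamma>)"

section \<open>Terms-in-context and generalizations\<close>

type_synonym 'f tic = "ctx \<times> 'f hedge"

definition is_tic :: "'f tic \<Rightarrow> bool" where
  "is_tic T \<longleftrightarrow> finite (fst T) \<and> wf_hedge (snd T)"

definition more_general :: "'f tic \<Rightarrow> 'f tic \<Rightarrow> bool" where
  "more_general T1 T2 \<longleftrightarrow> (\<exists>\<sigma>. is_subst \<sigma> \<and> respects_ctx \<sigma> (fst T1) \<and>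
     ctx_subst (fst T1) \<sigma> \<subseteq> fst T2 \<and> equiv_hedge (fst T2) (subst_hedge \<sigma> (snd T1)) (snd T2))"

definition generalization :: "'f tic \<Rightarrow> 'f tic \<Rightarrow> 'f tic \<Rightarrow> bool" where
  "generalization G T1 T2 \<longleftrightarrow> is_tic G \<and> more_general G T1 \<and> more_general G T2"

definition based_perm :: "atom set \<Rightarrow> atom perm \<Rightarrow> bool" where
  "based_perm A \<pi> \<longleftrightarrow> affected \<pi> \<subseteq> A"

definition based_hedge :: "atom set \<Rightarrow> 'f hedge \<Rightarrow> bool" where
  "based_hedge A s \<longleftrightarrow> atoms_hedge s \<subseteq> A"

definition based_ctx :: "atom set \<Rightarrow> ctx \<Rightarrow> bool" where
  "based_ctx A \<Delta> \<longleftrightarrow> atoms_ctx \<Delta> \<subseteq> A"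

definition based_tic :: "atom set \<Rightarrow> 'f tic \<Rightarrow> bool" where
  "based_tic A T \<longleftrightarrow> based_ctx A (fst T) \<and> based_hedge A (snd T)"

section \<open>The anti-unification algorithm\<close>

text \<open>The triple \<open>(\<chi>, l, r)\<close> stands for the anti-unification problem \<open>\<chi>: l \<triangleq> r\<close>.\<close>

type_synonym 'f aup = "var \<times> 'f hedge \<times> 'f hedge"

type_synonym 'f state = "'f aup set \<times> 'f aup set \<times> ctx \<times> 'f subst"

definition vars_aups :: "'f aup set \<Rightarrow> var set" where
  "vars_aups P = (\<Union>(\<chi>, l, r)\<in>P. {\<chi>} \<union> vars_hedge l \<union> vars_hedge r)"

fun vars_state :: "'f state \<Rightarrow> var set" where
  "vars_state (P, S, \<Gamma>, \<sigma>) = vars_aups P \<union> vars_aups S \<union> vars_ctx \<Gamma> \<union> vars_subst \<sigma>"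

definition new_var :: "ctx \<Rightarrow> 'f state \<Rightarrow> var \<Rightarrow> bool" where
  "new_var \<Delta> st \<chi> \<longleftrightarrow> \<chi> \<notin> vars_state st \<union> vars_ctx \<Delta>"

definition abs_atom :: "atom set \<Rightarrow> ctx \<Rightarrow> 'f elem \<Rightarrow> 'f elem \<Rightarrow> atom \<Rightarrow> bool" where
  "abs_atom A \<Delta> t1 t2 c \<longleftrightarrow> c \<in> A \<and> fresh \<Delta> c t1 \<and> fresh \<Delta> c t2"

definition store_ctx :: "atom set \<Rightarrow> ctx \<Rightarrow> var \<Rightarrow> 'f hedge \<Rightarrow> 'f hedge \<Rightarrow> ctx" where
  "store_ctx A \<Delta> \<chi> l r = {(a, \<chi>) | a. a \<in> A \<and> fresh_hedge \<Delta> a l \<and> fresh_hedge \<Delta> a r}"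

text \<open>
  Two rules need an explanation:

  \<^item> \<open>Sol_T_Abs\<close> stores a pair of abstractions for which \<open>Abs_T\<close> has no admissible bound
    atom. Without it the algorithm is incomplete: for \<open>A = {a, b}\<close>,
    \<open>l = a.f(a,b)\<close> and \<open>r = b.f(a,b)\<close> no \<open>c\<close> in \<open>A\<close> is fresh for both sides, and the heads
    agree, so that only \<open>Dec_H\<close> would be applicable. It instantiates \<open>X\<close> by a hedge of
    length 2, which is not an instance of the generalization consisting of an
    individual variable \<open>x\<close>. The rule is the usual third case of the solving rule
    of nominal anti-unification, \<open>both sides are abstractions and the abstraction rule does
    not apply\<close>.

  \<^item> In \<open>Mer\<close> the mapping from \<open>\<chi>2\<close> to \<open>\<pi>\<cdot>\<chi>1\<close> has to be a substitution, hence an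
    individual variable cannot be replaced by a suspended hedge variable.
\<close>

inductive vnau :: "atom set \<Rightarrow> ctx \<Rightarrow> 'f state \<Rightarrow> 'f state \<Rightarrow> bool"
  for A :: "atom set" and \<Delta> :: ctx where
  Tri_T:
    "(HV X, [Atom a], [Atom a]) \<notin> P \<Longrightarrow>
     vnau A \<Delta> (insert (HV X, [Atom a], [Atom a]) P, S, \<Gamma>, \<sigma>)
              (P, S, \<Gamma>, subst_upd \<sigma> (HV X) [Atom a])"
| Tri_H:
    "(HV X, [], []) \<notin> P \<Longrightarrow>
     vnau A \<Delta> (insert (HV X, [], []) P, S, \<Gamma>, \<sigma>)
              (P, S, \<Gamma>, subst_upd \<sigma> (HV X) [])"
| Dec_T:
    "(HV X, [Fun f s], [Fun f q]) \<notin> P \<Longrightarrow>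
     new_var \<Delta> (insert (HV X, [Fun f s], [Fun f q]) P, S, \<Gamma>, \<sigma>) (HV Y) \<Longrightarrow>
     vnau A \<Delta> (insert (HV X, [Fun f s], [Fun f q]) P, S, \<Gamma>, \<sigma>)
              (insert (HV Y, s, q) P, S, \<Gamma>, subst_upd \<sigma> (HV X) [Fun f [Susp 1 (HV Y)]])"
| Dec_H:
    "(HV X, s1 @ s2, q1 @ q2) \<notin> P \<Longrightarrow>
     length (s1 @ q1) = 1 \<or> length s1 = 1 \<and> length q1 = 1 \<Longrightarrow>
     length (s2 @ q2) \<ge> 1 \<Longrightarrow>
     new_var \<Delta> (insert (HV X, s1 @ s2, q1 @ q2) P, S, \<Gamma>, \<sigma>) (HV Y1) \<Longrightarrow>
     new_var \<Delta> (insert (HV X, s1 @ s2, q1 @ q2) P, S, \<Gamma>, \<sigma>) (HV Y2) \<Longrightarrow>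
     Y1 \<noteq> Y2 \<Longrightarrow>
     vnau A \<Delta> (insert (HV X, s1 @ s2, q1 @ q2) P, S, \<Gamma>, \<sigma>)
              ({(HV Y1, s1, q1), (HV Y2, s2, q2)} \<union> P, S, \<Gamma>,
               subst_upd \<sigma> (HV X) [Susp 1 (HV Y1), Susp 1 (HV Y2)])"
| Abs_T:
    "(HV X, [Abs a t1], [Abs b t2]) \<notin> P \<Longrightarrow>
     abs_atom A \<Delta> (Abs a t1) (Abs b t2) c \<Longrightarrow>
     new_var \<Delta> (insert (HV X, [Abs a t1], [Abs b t2]) P, S, \<Gamma>, \<sigma>) (HV Y) \<Longrightarrow>
     vnau A \<Delta> (insert (HV X, [Abs a t1], [Abs b t2]) P, S, \<Gamma>, \<sigma>)
              (insert (HV Y, act_hedge \<langle>c \<leftrightarrow> a\<rangle> t1, act_hedge \<langle>c \<leftrightarrow> b\<rangle> t2) P, S, \<Gamma>,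
               subst_upd \<sigma> (HV X) [Abs c [Susp 1 (HV Y)]])"
| Sol_T:
    "(HV X, [r1], [r2]) \<notin> P \<Longrightarrow>
     is_susp r1 \<and> is_susp r2 \<or> head r1 \<noteq> head r2 \<Longrightarrow>
     vnau A \<Delta> (insert (HV X, [r1], [r2]) P, S, \<Gamma>, \<sigma>)
              (P, insert (HV X, [r1], [r2]) S, store_ctx A \<Delta> (HV X) [r1] [r2] \<union> \<Gamma>, \<sigma>)"
| Sol_T_Abs:
    "(HV X, [Abs a t1], [Abs b t2]) \<notin> P \<Longrightarrow>
     \<not> (\<exists>c. abs_atom A \<Delta> (Abs a t1) (Abs b t2) c) \<Longrightarrow>
     vnau A \<Delta> (insert (HV X, [Abs a t1], [Abs b t2]) P, S, \<Gamma>, \<sigma>)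
              (P, insert (HV X, [Abs a t1], [Abs b t2]) S,
               store_ctx A \<Delta> (HV X) [Abs a t1] [Abs b t2] \<union> \<Gamma>, \<sigma>)"
| Sol_H:
    "(HV X, s, q) \<notin> P \<Longrightarrow>
     length (s @ q) = 1 \<Longrightarrow>
     vnau A \<Delta> (insert (HV X, s, q) P, S, \<Gamma>, \<sigma>)
              (P, insert (HV X, s, q) S, store_ctx A \<Delta> (HV X) s q \<union> \<Gamma>, \<sigma>)"
| Mer:
    "(\<chi>1, l1, r1) \<noteq> (\<chi>2, l2, r2) \<Longrightarrow>
     (\<chi>1, l1, r1) \<notin> S \<Longrightarrow> (\<chi>2, l2, r2) \<notin> S \<Longrightarrow>
     (\<exists>x. \<chi>2 = IV x) \<longrightarrow> (\<exists>y. \<chi>1 = IV y) \<Longrightarrow>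
     based_perm A \<pi> \<Longrightarrow>
     equiv_hedge \<Delta> (act_hedge \<pi> l1) l2 \<Longrightarrow> equiv_hedge \<Delta> (act_hedge \<pi> r1) r2 \<Longrightarrow>
     vnau A \<Delta> (P, {(\<chi>1, l1, r1), (\<chi>2, l2, r2)} \<union> S, \<Gamma>, \<sigma>)
              (P, insert (\<chi>1, l1, r1) S,
               ctx_subst \<Gamma> (single \<chi>2 [Susp \<pi> \<chi>1] :: 'f subst), subst_upd \<sigma> \<chi>2 [Susp \<pi> \<chi>1])"
| Nar_T:
    "(HV X, [t1], [t2]) \<notin> S \<Longrightarrow>
     wf_iterm t1 \<Longrightarrow> wf_iterm t2 \<Longrightarrow>
     new_var \<Delta> (P, insert (HV X, [t1], [t2]) S, \<Gamma>, \<sigma>) (IV x) \<Longrightarrow>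
     vnau A \<Delta> (P, insert (HV X, [t1], [t2]) S, \<Gamma>, \<sigma>)
              (P, insert (IV x, [t1], [t2]) S,
               ctx_subst \<Gamma> (single (HV X) [Susp 1 (IV x)] :: 'f subst),
               subst_upd \<sigma> (HV X) [Susp 1 (IV x)])"

text \<open>The rules are applied exhaustively: the last state admits no further step.\<close>

definition vnau_execution :: "atom set \<Rightarrow> ctx \<Rightarrow> 'f state \<Rightarrow> 'f state \<Rightarrow> bool" where
  "vnau_execution A \<Delta> st st' \<longleftrightarrow> (vnau A \<Delta>)\<^sup>+\<^sup>+ st st' \<and> \<not> (\<exists>st''. vnau A \<Delta> st' st'')"

end

theory Submission
  imports Defs
begin

text \<open>
  A derivation is chosen as follows. While a problem \<open>s \<triangleq> q\<close> is generalized by a subhedge \<open>u\<close> of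
  \<open>G\<close>, the algorithm aligns \<open>s\<close> and \<open>q\<close> and chooses bound atoms in the way \<open>u\<close> does. Below a
  variable of \<open>G\<close> it aligns position by position from the left and decomposes as far as possible.
  Then the store is merged and narrowed exhaustively.

  After exhaustive merging, the second kind of decomposition is unique: equivalent problems get
  decompositions that are equivalent under the final freshness context, whatever bound atoms were
  chosen, because two problems in the store that are related by an \<open>A\<close>-based permutation share their
  variable, and because the store records all atoms of \<open>A\<close> fresh for both sides. The unique
  decomposition is also equivariant under \<open>A\<close>-based permutations. Hence all the occurrences
  \<open>\<pi>\<cdot>\<chi>\<close> of a variable of \<open>G\<close> are refined by \<open>\<pi>\<cdot>w\<close> for a single hedge \<open>w\<close>, and \<open>\<chi> \<mapsto> w\<close> is the
  substitution that instantiates \<open>G\<close>.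
\<close>

section \<open>Nominal hedges\<close>

lemma apply_mult [simp]: "(\<pi> * \<rho>) \<langle>$\<rangle> a = \<pi> \<langle>$\<rangle> (\<rho> \<langle>$\<rangle> a)"
  by (simp add: apply_times)

lemma apply_inverse_apply [simp]: "inverse \<pi> \<langle>$\<rangle> (\<pi> \<langle>$\<rangle> a) = a"
  by (simp add: apply_inverse bij_is_inj)

lemma apply_apply_inverse [simp]: "\<pi> \<langle>$\<rangle> (inverse \<pi> \<langle>$\<rangle> a) = a"
  by (simp add: apply_inverse bij_is_surj surj_f_inv_f)

lemma inverse_apply_eq_iff: "inverse \<pi> \<langle>$\<rangle> a = b \<longleftrightarrow> a = \<pi> \<langle>$\<rangle> b"
  by auto

lemma apply_eq_apply [simp]: "\<pi> \<langle>$\<rangle> a = \<pi> \<langle>$\<rangle> b \<longleftrightarrow> a = b"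
  by (rule apply_inj)

lemma mult_swap: "\<pi> * \<langle>a \<leftrightarrow> b\<rangle> = \<langle>\<pi> \<langle>$\<rangle> a \<leftrightarrow> \<pi> \<langle>$\<rangle> b\<rangle> * \<pi>"
proof (rule perm_eqI)
  fix c
  show "(\<pi> * \<langle>a \<leftrightarrow> b\<rangle>) \<langle>$\<rangle> c = (\<langle>\<pi> \<langle>$\<rangle> a \<leftrightarrow> \<pi> \<langle>$\<rangle> b\<rangle> * \<pi>) \<langle>$\<rangle> c"
    by (cases "c = a"; cases "c = b") auto
qed

lemma apply_swap: "\<langle>a \<leftrightarrow> b\<rangle> \<langle>$\<rangle> c = (if c = a then b else if c = b then a else c)"
  by auto

lemma based_perm_apply: "based_perm A \<pi> \<Longrightarrow> \<pi> \<langle>$\<rangle> a \<in> A \<longleftrightarrow> a \<in> A"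
  unfolding based_perm_def by (metis apply_affected in_affected subsetD)

lemma based_perm_inverse [simp]: "based_perm A (inverse \<pi>) \<longleftrightarrow> based_perm A \<pi>"
  by (simp add: based_perm_def)

lemma based_perm_one [simp]: "based_perm A 1"
  by (simp add: based_perm_def)

lemma based_perm_mult: "based_perm A \<pi> \<Longrightarrow> based_perm A \<rho> \<Longrightarrow> based_perm A (\<pi> * \<rho>)"
  unfolding based_perm_def using affected_times[of \<pi> \<rho>] by blast

lemma based_perm_swap: "a \<in> A \<Longrightarrow> b \<in> A \<Longrightarrow> based_perm A \<langle>a \<leftrightarrow> b\<rangle>"
  by (cases "a = b") (auto simp: based_perm_def affected_swap)

text \<open>Elements and hedges are nested in each other, so the induction runs on hedges alone: the
  body of the first element and the remaining hedge are both smaller in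
  \<open>size_list size\<close>.\<close>

lemma hedge_induct [case_names Nil Atom Susp Abs Fun]:
  fixes s :: "'f hedge"
  assumes "P []"
    and "\<And>a s. P s \<Longrightarrow> P (Atom a # s)"
    and "\<And>\<pi> \<chi> s. P s \<Longrightarrow> P (Susp \<pi> \<chi> # s)"
    and "\<And>a w s. P w \<Longrightarrow> P s \<Longrightarrow> P (Abs a w # s)"
    and "\<And>f w s. P w \<Longrightarrow> P s \<Longrightarrow> P (Fun f w # s)"
  shows "P s"
proof (induction s rule: measure_induct_rule[of "size_list size"])
  case (less s)
  show ?case
  proof (cases s)
    case Nil
    then show ?thesis using assms(1) by simp
  next
    case (Cons t s')
    then have "P s'" by (intro less.IH) simp
    then show ?thesis using Cons assms less.IH by (cases t) auto
  qed
qed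

section \<open>Recursion equations for the operations on hedges\<close>

lemma act_hedge_simps [simp]:
  "act_hedge \<pi> [] = []"
  "act_hedge \<pi> (t # s) = act \<pi> t # act_hedge \<pi> s"
  "act_hedge \<pi> (s @ q) = act_hedge \<pi> s @ act_hedge \<pi> q"
  "act_hedge \<pi> s = [] \<longleftrightarrow> s = []"
  "length (act_hedge \<pi> s) = length s"
  by (simp_all add: act_hedge_def)

lemma act_simps [simp]:
  "act \<pi> (Abs a s) = Abs (\<pi> \<langle>$\<rangle> a) (act_hedge \<pi> s)"
  "act \<pi> (Fun f s) = Fun f (act_hedge \<pi> s)"
  by (simp_all add: act_hedge_def)

declare act.simps(3,4) [simp del]

lemma subst_hedge_simps [simp]:
  "subst_hedge \<sigma> [] = []"
  "subst_hedge \<sigma> (t # s) = subst_elem \<sigma> t @ subst_hedge \<sigma> s"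
  "subst_hedge \<sigma> (s @ q) = subst_hedge \<sigma> s @ subst_hedge \<sigma> q"
  by (simp_all add: subst_hedge_def)

lemma subst_elem_simps [simp]:
  "subst_elem \<sigma> (Abs a s) = [Abs a (subst_hedge \<sigma> s)]"
  "subst_elem \<sigma> (Fun f s) = [Fun f (subst_hedge \<sigma> s)]"
  by (simp_all add: subst_hedge_def)

declare subst_elem.simps(3,4) [simp del]

lemma fresh_hedge_simps [simp]:
  "fresh_hedge \<Delta> a []"
  "fresh_hedge \<Delta> a (t # s) \<longleftrightarrow> fresh \<Delta> a t \<and> fresh_hedge \<Delta> a s"
  "fresh_hedge \<Delta> a (s @ q) \<longleftrightarrow> fresh_hedge \<Delta> a s \<and> fresh_hedge \<Delta> a q"
  by (auto simp: fresh_hedge_def)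

lemma fresh_simps [simp]:
  "fresh \<Delta> a (Abs b s) \<longleftrightarrow> a = b \<or> fresh_hedge \<Delta> a s"
  "fresh \<Delta> a (Fun f s) \<longleftrightarrow> fresh_hedge \<Delta> a s"
  by (auto simp: fresh_hedge_def)

declare fresh.simps(3,4) [simp del]

lemma wf_hedge_simps [simp]:
  "wf_hedge []"
  "wf_hedge (t # s) \<longleftrightarrow> wf_elem t \<and> wf_hedge s"
  "wf_hedge (s @ q) \<longleftrightarrow> wf_hedge s \<and> wf_hedge q"
  by (auto simp: wf_hedge_def)

lemma wf_elem_simps [simp]:
  "wf_elem (Abs a s) \<longleftrightarrow> (\<exists>t. s = [t] \<and> wf_iterm t)"
  "wf_elem (Fun f s) \<longleftrightarrow> wf_hedge s"
  by (auto simp: wf_hedge_def wf_iterm_def length_Suc_conv)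

declare wf_elem.simps(3,4) [simp del]

lemma vars_hedge_simps [simp]:
  "vars_hedge [] = {}"
  "vars_hedge (t # s) = vars_elem t \<union> vars_hedge s"
  "vars_hedge (s @ q) = vars_hedge s \<union> vars_hedge q"
  by (auto simp: vars_hedge_def)

lemma vars_elem_simps [simp]:
  "vars_elem (Abs a s) = vars_hedge s"
  "vars_elem (Fun f s) = vars_hedge s"
  by (auto simp: vars_hedge_def)

declare vars_elem.simps(3,4) [simp del]

lemma atoms_hedge_simps [simp]:
  "atoms_hedge [] = {}"
  "atoms_hedge (t # s) = atoms_elem t \<union> atoms_hedge s"
  by (auto simp: atoms_hedge_def)

lemma atoms_elem_simps [simp]:
  "atoms_elem (Abs a s) = insert a (atoms_hedge s)"
  "atoms_elem (Fun f s) = atoms_hedge s"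
  by (auto simp: atoms_hedge_def)

declare atoms_elem.simps(3,4) [simp del]

lemma equiv_hedge_simps [simp]:
  "equiv_hedge \<Delta> [] q \<longleftrightarrow> q = []"
  "equiv_hedge \<Delta> s [] \<longleftrightarrow> s = []"
  "equiv_hedge \<Delta> (t # s) (t' # q) \<longleftrightarrow> equiv_elem \<Delta> t t' \<and> equiv_hedge \<Delta> s q"
  by (auto simp: equiv_hedge_def)

lemma equiv_hedge_Cons1:
  "equiv_hedge \<Delta> (t # s) q \<longleftrightarrow> (\<exists>t' q'. q = t' # q' \<and> equiv_elem \<Delta> t t' \<and> equiv_hedge \<Delta> s q')"
  by (auto simp: equiv_hedge_def list_all2_Cons1)

lemma equiv_hedge_append1:
  "equiv_hedge \<Delta> (s @ s') q \<longleftrightarrow>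
    (\<exists>q1 q2. q = q1 @ q2 \<and> equiv_hedge \<Delta> s q1 \<and> equiv_hedge \<Delta> s' q2)"
  by (auto simp: equiv_hedge_def list_all2_append1) (metis list_all2_lengthD)+

lemma equiv_hedge_append:
  "equiv_hedge \<Delta> s q \<Longrightarrow> equiv_hedge \<Delta> s' q' \<Longrightarrow> equiv_hedge \<Delta> (s @ s') (q @ q')"
  by (auto simp: equiv_hedge_def intro: list_all2_appendI)

inductive_cases equiv_AtomE: "equiv_elem \<Delta> (Atom a) t"
inductive_cases equiv_SuspE: "equiv_elem \<Delta> (Susp \<pi> \<chi>) t"
inductive_cases equiv_AbsE: "equiv_elem \<Delta> (Abs a s) t"
inductive_cases equiv_FunE: "equiv_elem \<Delta> (Fun f s) t"

section \<open>Freshness and alpha-equivalence under permutations\<close>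

lemma act_hedge_one [simp]: "act_hedge 1 s = s"
  by (induction s rule: hedge_induct) simp_all

lemma act_hedge_mult [simp]: "act_hedge \<pi> (act_hedge \<rho> s) = act_hedge (\<pi> * \<rho>) s"
  by (induction s rule: hedge_induct) (simp_all add: mult.assoc)

lemma equiv_Atom_iff [simp]: "equiv_elem \<Delta> (Atom a) t \<longleftrightarrow> t = Atom a"
  by (auto elim: equiv_AtomE intro: equiv_elem.intros)

lemma equiv_Fun_iff: "equiv_elem \<Delta> (Fun f s) t \<longleftrightarrow> (\<exists>q. t = Fun f q \<and> equiv_hedge \<Delta> s q)"
  by (auto simp: equiv_hedge_def elim: equiv_FunE intro: equiv_elem.intros)

lemma equiv_Susp_iff:
  "equiv_elem \<Delta> (Susp \<pi> \<chi>) t \<longleftrightarrow>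
    (\<exists>\<pi>'. t = Susp \<pi>' \<chi> \<and> (\<forall>a. \<pi> \<langle>$\<rangle> a \<noteq> \<pi>' \<langle>$\<rangle> a \<longrightarrow> (a, \<chi>) \<in> \<Delta>))"
  by (auto elim: equiv_SuspE intro: equiv_elem.intros)

text \<open>With the convention \<open>\<langle>a \<leftrightarrow> a\<rangle> = 1\<close> the two abstraction rules become one.\<close>

lemma equiv_Abs_iff:
  "equiv_elem \<Delta> (Abs a s) t \<longleftrightarrow>
    (\<exists>b q. t = Abs b q \<and> equiv_hedge \<Delta> s (act_hedge \<langle>a \<leftrightarrow> b\<rangle> q) \<and> fresh \<Delta> a (Abs b q))"
proof
  assume "equiv_elem \<Delta> (Abs a s) t"
  then show "\<exists>b q. t = Abs b q \<and> equiv_hedge \<Delta> s (act_hedge \<langle>a \<leftrightarrow> b\<rangle> q) \<and> fresh \<Delta> a (Abs b q)"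
    by (rule equiv_AbsE) (auto simp: equiv_hedge_def fresh_hedge_def)
next
  assume "\<exists>b q. t = Abs b q \<and> equiv_hedge \<Delta> s (act_hedge \<langle>a \<leftrightarrow> b\<rangle> q) \<and> fresh \<Delta> a (Abs b q)"
  then obtain b q where *: "t = Abs b q" "equiv_hedge \<Delta> s (act_hedge \<langle>a \<leftrightarrow> b\<rangle> q)" "fresh \<Delta> a (Abs b q)"
    by blast
  show "equiv_elem \<Delta> (Abs a s) t"
  proof (cases "a = b")
    case True
    then show ?thesis using * by (auto simp: equiv_hedge_def intro: equiv_Abs_same)
  next
    case False
    then show ?thesis using * by (auto simp: equiv_hedge_def intro: equiv_Abs_diff)
  qed
qed

lemmas equiv_iffs = equiv_Fun_iff equiv_Susp_iff equiv_Abs_iff equiv_hedge_Cons1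

lemma fresh_hedge_act: "fresh_hedge \<Delta> a (act_hedge \<pi> s) \<longleftrightarrow> fresh_hedge \<Delta> (inverse \<pi> \<langle>$\<rangle> a) s"
  by (induction s rule: hedge_induct) (auto simp: inverse_apply_eq_iff)

lemma fresh_act: "fresh \<Delta> a (act \<pi> t) \<longleftrightarrow> fresh \<Delta> (inverse \<pi> \<langle>$\<rangle> a) t"
  using fresh_hedge_act[of \<Delta> a \<pi> "[t]"] by simp

lemma fresh_hedge_act_apply: "fresh_hedge \<Delta> (\<pi> \<langle>$\<rangle> a) (act_hedge \<pi> s) \<longleftrightarrow> fresh_hedge \<Delta> a s"
  by (simp add: fresh_hedge_act)

lemma equiv_hedge_act: "equiv_hedge \<Delta> s q \<Longrightarrow> equiv_hedge \<Delta> (act_hedge \<pi> s) (act_hedge \<pi> q)"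
proof (induction s arbitrary: q rule: hedge_induct)
  case (Abs a w s)
  from Abs.prems obtain b u q' where q: "q = Abs b u # q'" and
    w: "equiv_hedge \<Delta> w (act_hedge \<langle>a \<leftrightarrow> b\<rangle> u)" "a = b \<or> fresh_hedge \<Delta> a u" and s: "equiv_hedge \<Delta> s q'"
    by (auto simp: equiv_iffs)
  show ?case
    using Abs.IH(1)[OF w(1)] Abs.IH(2)[OF s] w(2)
    by (auto simp: q equiv_iffs mult_swap fresh_hedge_act_apply)
qed (auto simp: equiv_iffs)

lemma equiv_hedge_act_iff: "equiv_hedge \<Delta> (act_hedge \<pi> s) (act_hedge \<pi> q) \<longleftrightarrow> equiv_hedge \<Delta> s q"
  using equiv_hedge_act[of \<Delta> s q \<pi>] equiv_hedge_act[of \<Delta> "act_hedge \<pi> s" "act_hedge \<pi> q" "inverse \<pi>"]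
  by auto

lemma equiv_hedge_fresh: "equiv_hedge \<Delta> s q \<Longrightarrow> fresh_hedge \<Delta> c s \<longleftrightarrow> fresh_hedge \<Delta> c q"
proof (induction s arbitrary: q rule: hedge_induct)
  case (Susp \<pi> \<chi> s)
  from Susp.prems obtain \<pi>' q' where q: "q = Susp \<pi>' \<chi> # q'" "equiv_hedge \<Delta> s q'"
    and *: "\<And>a. \<pi> \<langle>$\<rangle> a \<noteq> \<pi>' \<langle>$\<rangle> a \<Longrightarrow> (a, \<chi>) \<in> \<Delta>"
    by (auto simp: equiv_iffs)
  \<comment> \<open>If the two preimages of \<open>c\<close> differ, then \<pi> and
    \<open>\<pi>'\<close> disagree at each of them, so \<Delta> constrains both.\<close>
  have "(inverse \<pi> \<langle>$\<rangle> c, \<chi>) \<in> \<Delta> \<longleftrightarrow> (inverse \<pi>' \<langle>$\<rangle> c, \<chi>) \<in> \<Delta>"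
    using *[of "inverse \<pi> \<langle>$\<rangle> c"] *[of "inverse \<pi>' \<langle>$\<rangle> c"]
    by (metis apply_apply_inverse apply_inverse_apply)
  then show ?case using Susp.IH q by simp
next
  case (Abs a w s)
  from Abs.prems obtain b u q' where q: "q = Abs b u # q'" and
    w: "equiv_hedge \<Delta> w (act_hedge \<langle>a \<leftrightarrow> b\<rangle> u)" "a = b \<or> fresh_hedge \<Delta> a u" and s: "equiv_hedge \<Delta> s q'"
    by (auto simp: equiv_iffs)
  show ?case
    using Abs.IH(1)[OF w(1)] Abs.IH(2)[OF s] w(2)
    by (auto simp: q fresh_hedge_act apply_swap)
qed (auto simp: equiv_iffs)

lemma equiv_fresh: "equiv_elem \<Delta> t t' \<Longrightarrow> fresh \<Delta> c t \<longleftrightarrow> fresh \<Delta> c t'"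
  using equiv_hedge_fresh[of \<Delta> "[t]" "[t']" c] by simp

text \<open>A suspension shifts the disagreement set along its own permutation, and an abstraction
  removes its bound atom from it. The lemma gives reflexivity and carries the transitivity of
  abstractions and the uniqueness of holes.\<close>

lemma equiv_act_act_iff:
  "equiv_hedge \<Delta> (act_hedge \<pi> s) (act_hedge \<pi>' s) \<longleftrightarrow>
    (\<forall>a. \<pi> \<langle>$\<rangle> a \<noteq> \<pi>' \<langle>$\<rangle> a \<longrightarrow> fresh_hedge \<Delta> a s)"
proof (induction s arbitrary: \<pi> \<pi>' rule: hedge_induct)
  case (Susp \<rho> \<chi> s)
  have "(\<forall>a. \<pi> \<langle>$\<rangle> (\<rho> \<langle>$\<rangle> a) \<noteq> \<pi>' \<langle>$\<rangle> (\<rho> \<langle>$\<rangle> a) \<longrightarrow> (a, \<chi>) \<in> \<Delta>) \<longleftrightarrow>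
      (\<forall>a. \<pi> \<langle>$\<rangle> a \<noteq> \<pi>' \<langle>$\<rangle> a \<longrightarrow> (inverse \<rho> \<langle>$\<rangle> a, \<chi>) \<in> \<Delta>)"
    by (metis apply_apply_inverse apply_inverse_apply)
  then show ?case by (auto simp: equiv_Susp_iff Susp.IH)
next
  case (Abs b w s)
  \<comment> \<open>Swapping \<open>?x\<close> and \<open>?y\<close> aligns \<open>\<pi>'\<close>
    with \<pi> at \<open>b\<close>. The only other disagreement it can hide is at the preimage of
    \<open>?x\<close> under \<open>\<pi>'\<close>, which \<open>?L2\<close> covers.\<close>
  let ?x = "\<pi> \<langle>$\<rangle> b" and ?y = "\<pi>' \<langle>$\<rangle> b"
  have "(\<forall>a. \<pi> \<langle>$\<rangle> a \<noteq> (\<langle>?x \<leftrightarrow> ?y\<rangle> * \<pi>') \<langle>$\<rangle> a \<longrightarrow> fresh_hedge \<Delta> a w) \<and>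
      (?x = ?y \<or> fresh_hedge \<Delta> (inverse \<pi>' \<langle>$\<rangle> ?x) w) \<longleftrightarrow>
      (\<forall>a. \<pi> \<langle>$\<rangle> a \<noteq> \<pi>' \<langle>$\<rangle> a \<longrightarrow> a = b \<or> fresh_hedge \<Delta> a w)" (is "?L1 \<and> ?L2 \<longleftrightarrow> ?R")
  proof (intro iffI conjI)
    assume L: "?L1 \<and> ?L2"
    show ?R
    proof (intro allI impI)
      fix a assume a: "\<pi> \<langle>$\<rangle> a \<noteq> \<pi>' \<langle>$\<rangle> a"
      show "a = b \<or> fresh_hedge \<Delta> a w"
      proof (cases "a = b \<or> \<pi> \<langle>$\<rangle> a \<noteq> (\<langle>?x \<leftrightarrow> ?y\<rangle> * \<pi>') \<langle>$\<rangle> a")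
        case True
        then show ?thesis using L by blast
      next
        case False
        then have "\<pi>' \<langle>$\<rangle> a = ?x" using a by (auto simp: apply_swap split: if_splits)
        then have "a = inverse \<pi>' \<langle>$\<rangle> ?x" by (metis apply_inverse_apply)
        then show ?thesis using L \<open>\<pi>' \<langle>$\<rangle> a = ?x\<close> False by auto
      qed
    qed
  next
    assume R: ?R
    show ?L1
    proof (intro allI impI)
      fix a assume a: "\<pi> \<langle>$\<rangle> a \<noteq> (\<langle>?x \<leftrightarrow> ?y\<rangle> * \<pi>') \<langle>$\<rangle> a"
      then have "\<pi> \<langle>$\<rangle> a \<noteq> \<pi>' \<langle>$\<rangle> a" "a \<noteq> b" by (auto simp: apply_swap split: if_splits)
      then show "fresh_hedge \<Delta> a w" using R by blast
    qed
    show ?L2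
    proof (cases "?x = ?y")
      case False
      then have "\<pi> \<langle>$\<rangle> (inverse \<pi>' \<langle>$\<rangle> ?x) \<noteq> \<pi>' \<langle>$\<rangle> (inverse \<pi>' \<langle>$\<rangle> ?x)" "inverse \<pi>' \<langle>$\<rangle> ?x \<noteq> b"
        by (auto simp: inverse_apply_eq_iff)
      then show ?thesis using R by blast
    qed simp
  qed
  then show ?case
    by (auto simp: equiv_Abs_iff Abs.IH fresh_hedge_act)
next
  case (Atom b s)
  then show ?case by (auto; metis)
qed (auto simp: equiv_Fun_iff)

lemma equiv_hedge_refl [simp]: "equiv_hedge \<Delta> s s"
  using equiv_act_act_iff[of \<Delta> 1 s 1] by simp

lemma equiv_elem_refl [simp]: "equiv_elem \<Delta> t t"
  by (metis equiv_hedge_refl equiv_hedge_simps(3))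

lemma equiv_hedge_trans: "equiv_hedge \<Delta> s q \<Longrightarrow> equiv_hedge \<Delta> q r \<Longrightarrow> equiv_hedge \<Delta> s r"
proof (induction s arbitrary: q r rule: hedge_induct)
  case (Susp \<pi> \<chi> s)
  then show ?case by (auto simp: equiv_iffs) metis+
next
  case (Abs a w s)
  from Abs.prems(1) obtain b u q' where q: "q = Abs b u # q'" and
    w: "equiv_hedge \<Delta> w (act_hedge \<langle>a \<leftrightarrow> b\<rangle> u)" "fresh \<Delta> a (Abs b u)" and s: "equiv_hedge \<Delta> s q'"
    by (auto simp: equiv_iffs)
  from Abs.prems(2) obtain c v r' where r: "r = Abs c v # r'" and
    u: "equiv_hedge \<Delta> u (act_hedge \<langle>b \<leftrightarrow> c\<rangle> v)" "fresh \<Delta> b (Abs c v)" and q': "equiv_hedge \<Delta> q' r'"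
    and bc: "equiv_elem \<Delta> (Abs b u) (Abs c v)"
    by (auto simp: equiv_iffs q)
  have a: "fresh \<Delta> a (Abs c v)" using equiv_fresh[OF bc] w(2) by blast
  have "equiv_hedge \<Delta> w (act_hedge \<langle>a \<leftrightarrow> b\<rangle> (act_hedge \<langle>b \<leftrightarrow> c\<rangle> v))"
    using Abs.IH(1)[OF w(1)] equiv_hedge_act[OF u(1)] by blast
  \<comment> \<open>The permutations disagree at most at \<open>a\<close> and \<open>b\<close>. Each
    of these is fresh for \<open>v\<close> unless it equals \<open>c\<close>, and then the
    permutations coincide.\<close>
  moreover have "equiv_hedge \<Delta> (act_hedge (\<langle>a \<leftrightarrow> b\<rangle> * \<langle>b \<leftrightarrow> c\<rangle>) v) (act_hedge \<langle>a \<leftrightarrow> c\<rangle> v)"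
    unfolding equiv_act_act_iff using a u(2) by (auto simp: apply_swap split: if_splits)
  ultimately have "equiv_hedge \<Delta> w (act_hedge \<langle>a \<leftrightarrow> c\<rangle> v)"
    using Abs.IH(1) by simp
  then show ?case using Abs.IH(2)[OF s q'] a by (auto simp: r equiv_iffs)
next
  case (Fun f w s)
  then show ?case by (auto simp: equiv_iffs)
qed (auto simp: equiv_iffs)

lemma equiv_hedge_sym: "equiv_hedge \<Delta> s q \<Longrightarrow> equiv_hedge \<Delta> q s"
proof (induction s arbitrary: q rule: hedge_induct)
  case (Susp \<pi> \<chi> s)
  then show ?case by (auto simp: equiv_iffs)
next
  case (Abs a w s)
  from Abs.prems obtain b u q' where q: "q = Abs b u # q'" and
    w: "equiv_hedge \<Delta> w (act_hedge \<langle>a \<leftrightarrow> b\<rangle> u)" "fresh \<Delta> a (Abs b u)" and s: "equiv_hedge \<Delta> s q'"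
    by (auto simp: equiv_iffs)
  have "equiv_hedge \<Delta> u (act_hedge \<langle>b \<leftrightarrow> a\<rangle> w)"
    using equiv_hedge_act[OF Abs.IH(1)[OF w(1)], of "\<langle>b \<leftrightarrow> a\<rangle>"] by (simp add: swap_sym)
  moreover have "fresh \<Delta> b (Abs a w)"
    using equiv_hedge_fresh[OF w(1), of b] w(2) by (auto simp: fresh_hedge_act)
  ultimately show ?case using Abs.IH(2)[OF s] by (auto simp: q equiv_iffs)
qed (auto simp: equiv_iffs)

lemma equiv_elem_trans: "equiv_elem \<Delta> s q \<Longrightarrow> equiv_elem \<Delta> q r \<Longrightarrow> equiv_elem \<Delta> s r"
  using equiv_hedge_trans[of \<Delta> "[s]" "[q]" "[r]"] by simp

lemma equiv_elem_sym: "equiv_elem \<Delta> s q \<Longrightarrow> equiv_elem \<Delta> q s"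
  using equiv_hedge_sym[of \<Delta> "[s]" "[q]"] by simp

lemma equiv_hedge_act_left:
  "equiv_hedge \<Delta> (act_hedge \<pi> s) q \<longleftrightarrow> equiv_hedge \<Delta> s (act_hedge (inverse \<pi>) q)"
  using equiv_hedge_act_iff[of \<Delta> "inverse \<pi>" "act_hedge \<pi> s" q] by simp

lemma equiv_Abs_rename: "fresh \<Delta> c (Abs a s) \<Longrightarrow> equiv_elem \<Delta> (Abs c (act_hedge \<langle>c \<leftrightarrow> a\<rangle> s)) (Abs a s)"
  by (simp add: equiv_Abs_iff)

lemma equiv_Abs_same_iff: "equiv_elem \<Delta> (Abs a s) (Abs a q) \<longleftrightarrow> equiv_hedge \<Delta> s q"
  by (simp add: equiv_Abs_iff)

lemma head_equiv: "equiv_elem \<Delta> t t' \<Longrightarrow> head t = head t'"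
  by (cases t) (auto simp: equiv_iffs)

lemma is_susp_head: "is_susp t \<longleftrightarrow> (\<exists>\<chi>. head t = HdVar \<chi>)"
  by (cases t) auto

lemma is_hsusp_head: "is_hsusp t \<longleftrightarrow> (\<exists>X. head t = HdVar (HV X))"
  by (cases t rule: is_hsusp.cases) auto

lemma is_hsusp_equiv: "equiv_elem \<Delta> t t' \<Longrightarrow> is_hsusp t \<longleftrightarrow> is_hsusp t'"
  by (simp add: head_equiv is_hsusp_head)

lemma head_act_inj: "head (act \<pi> t) = head (act \<pi> t') \<longleftrightarrow> head t = head t'"
  by (cases t; cases t') auto

lemma is_susp_act [simp]: "is_susp (act \<pi> t) \<longleftrightarrow> is_susp t"
  by (cases t) auto

lemma is_hsusp_act [simp]: "is_hsusp (act \<pi> t) \<longleftrightarrow> is_hsusp t"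
  by (cases t rule: is_hsusp.cases) auto

lemma wf_hedge_act [simp]: "wf_hedge (act_hedge \<pi> s) \<longleftrightarrow> wf_hedge s"
proof (induction s rule: hedge_induct)
  case (Abs a w s)
  have "(\<exists>t. act_hedge \<pi> w = [t] \<and> wf_iterm t) \<longleftrightarrow> (\<exists>t. w = [t] \<and> wf_iterm t)"
    using Abs.IH(1) by (cases w) (auto simp: wf_iterm_def)
  then show ?case using Abs.IH by simp
qed simp_all

lemma wf_elem_act [simp]: "wf_elem (act \<pi> t) \<longleftrightarrow> wf_elem t"
  using wf_hedge_act[of \<pi> "[t]"] by simp

lemma wf_iterm_act [simp]: "wf_iterm (act \<pi> t) \<longleftrightarrow> wf_iterm t"
  by (simp add: wf_iterm_def)

section \<open>Substitutions and instances of freshness contexts\<close>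

lemma subst_act: "subst_hedge \<sigma> (act_hedge \<pi> s) = act_hedge \<pi> (subst_hedge \<sigma> s)"
  by (induction s rule: hedge_induct) auto

definition comp_subst :: "'f subst \<Rightarrow> 'f subst \<Rightarrow> 'f subst" where
  "comp_subst \<sigma> \<tau> = (\<lambda>\<chi>. subst_hedge \<tau> (\<sigma> \<chi>))"

lemma subst_comp_subst: "subst_hedge (comp_subst \<sigma> \<tau>) s = subst_hedge \<tau> (subst_hedge \<sigma> s)"
  by (induction s rule: hedge_induct) (auto simp: comp_subst_def subst_act)

lemma comp_subst_assoc: "comp_subst (comp_subst \<rho> \<sigma>) \<tau> = comp_subst \<rho> (comp_subst \<sigma> \<tau>)"
  by (rule ext) (simp add: comp_subst_def subst_comp_subst[unfolded comp_subst_def])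

lemma subst_id [simp]: "subst_hedge id_subst s = s"
  by (induction s rule: hedge_induct) (auto simp: id_subst_def)

lemma comp_id [simp]: "comp_subst \<sigma> id_subst = \<sigma>" "comp_subst id_subst \<sigma> = \<sigma>"
  by (auto simp: comp_subst_def) (simp add: id_subst_def)

lemma subst_upd_eq_comp: "subst_upd \<sigma> \<chi> u = comp_subst \<sigma> (single \<chi> u)"
  by (simp add: subst_upd_def comp_subst_def)

lemma comp_single: "comp_subst (single \<chi> u) \<tau> \<chi>' = (if \<chi>' = \<chi> then subst_hedge \<tau> u else \<tau> \<chi>')"
  by (simp add: comp_subst_def single_def id_subst_def)

lemma fresh_hedge_mono: "\<Gamma> \<subseteq> \<Gamma>' \<Longrightarrow> fresh_hedge \<Gamma> a s \<Longrightarrow> fresh_hedge \<Gamma>' a s"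
  by (induction s rule: hedge_induct) auto

text \<open>Freshness is checked suspension by suspension, each asking for one constraint, so it
  passes to intersections. This makes the least context of an instance exist.\<close>

lemma fresh_hedge_Inter:
  "C \<noteq> {} \<Longrightarrow> \<forall>\<Gamma>\<in>C. fresh_hedge \<Gamma> a s \<Longrightarrow> fresh_hedge (\<Inter>C) a s"
  by (induction s rule: hedge_induct) auto

lemma ctx_instance_of_ctx_subst:
  assumes "respects_ctx \<sigma> \<Delta>"
  shows "ctx_instance_of \<Delta> \<sigma> (ctx_subst \<Delta> \<sigma>)"
    and "\<And>\<Gamma>. ctx_instance_of \<Delta> \<sigma> \<Gamma> \<Longrightarrow> ctx_subst \<Delta> \<sigma> \<subseteq> \<Gamma>"
proof -
  let ?C = "{\<Gamma>. ctx_instance_of \<Delta> \<sigma> \<Gamma>}"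
  have "?C \<noteq> {}" using assms by (auto simp: respects_ctx_def)
  then have inst: "ctx_instance_of \<Delta> \<sigma> (\<Inter>?C)"
    by (auto simp: ctx_instance_of_def intro!: fresh_hedge_Inter)
  have "ctx_subst \<Delta> \<sigma> = \<Inter>?C"
    unfolding ctx_subst_def by (rule Least_equality) (use inst in auto)
  with inst show "ctx_instance_of \<Delta> \<sigma> (ctx_subst \<Delta> \<sigma>)"
    "\<And>\<Gamma>. ctx_instance_of \<Delta> \<sigma> \<Gamma> \<Longrightarrow> ctx_subst \<Delta> \<sigma> \<subseteq> \<Gamma>" by auto
qed

text \<open>The least context lies in \<Gamma> exactly when \<Gamma> itself derives the instantiated
  constraints. Finiteness makes \<Gamma> a competitor for the least context.\<close>

lemma more_general_iff:
  assumes "finite \<Gamma>"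
  shows "more_general (\<Delta>, u) (\<Gamma>, v) \<longleftrightarrow>
    (\<exists>\<sigma>. is_subst \<sigma> \<and> (\<forall>(a, \<chi>)\<in>\<Delta>. fresh_hedge \<Gamma> a (\<sigma> \<chi>)) \<and> equiv_hedge \<Gamma> (subst_hedge \<sigma> u) v)"
proof -
  have "respects_ctx \<sigma> \<Delta> \<and> ctx_subst \<Delta> \<sigma> \<subseteq> \<Gamma> \<longleftrightarrow> (\<forall>(a, \<chi>)\<in>\<Delta>. fresh_hedge \<Gamma> a (\<sigma> \<chi>))"
    for \<sigma> :: "'a subst"
  proof
    assume "respects_ctx \<sigma> \<Delta> \<and> ctx_subst \<Delta> \<sigma> \<subseteq> \<Gamma>"
    then show "\<forall>(a, \<chi>)\<in>\<Delta>. fresh_hedge \<Gamma> a (\<sigma> \<chi>)"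
      using ctx_instance_of_ctx_subst(1)[of \<sigma> \<Delta>] fresh_hedge_mono[of "ctx_subst \<Delta> \<sigma>" \<Gamma>]
      by (fastforce simp: ctx_instance_of_def)
  next
    assume "\<forall>(a, \<chi>)\<in>\<Delta>. fresh_hedge \<Gamma> a (\<sigma> \<chi>)"
    then have "ctx_instance_of \<Delta> \<sigma> \<Gamma>" using assms by (simp add: ctx_instance_of_def)
    then show "respects_ctx \<sigma> \<Delta> \<and> ctx_subst \<Delta> \<sigma> \<subseteq> \<Gamma>"
      using ctx_instance_of_ctx_subst(2) by (auto simp: respects_ctx_def)
  qed
  then show ?thesis unfolding more_general_def fst_conv snd_conv by metis
qed

section \<open>Maximal decompositions over a store\<close>

text \<open>Merging may delete a solved problem from the store. What survives is a stored problem
  that an \<open>A\<close>-based \<pi> carries to it, and \<open>Susp \<pi> Z\<close> then stands in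
  for its variable.\<close>

definition hole :: "atom set \<Rightarrow> ctx \<Rightarrow> 'f aup set \<Rightarrow> atom perm \<Rightarrow> var \<Rightarrow> 'f hedge \<Rightarrow> 'f hedge \<Rightarrow> bool" where
  "hole A \<Delta> S \<pi> Z s q \<longleftrightarrow> based_perm A \<pi> \<and>
    (\<exists>l r. (Z, l, r) \<in> S \<and> equiv_hedge \<Delta> (act_hedge \<pi> l) s \<and> equiv_hedge \<Delta> (act_hedge \<pi> r) q)"

text \<open>Joins the conditions of \<open>Sol_T\<close> and \<open>Sol_T_Abs\<close>, so that a
  pair of elements is either stuck or admits one of \<open>Tri_T\<close>, \<open>Dec_T\<close>,
  \<open>Abs_T\<close>, never both.\<close>

definition stuck :: "atom set \<Rightarrow> ctx \<Rightarrow> 'f elem \<Rightarrow> 'f elem \<Rightarrow> bool" where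
  "stuck A \<Delta> t1 t2 \<longleftrightarrow> is_susp t1 \<and> is_susp t2 \<or> head t1 \<noteq> head t2 \<or>
    head t1 = HdAbs \<and> head t2 = HdAbs \<and> \<not> (\<exists>c. abs_atom A \<Delta> t1 t2 c)"

text \<open>
  \<open>cdec A \<Delta> S v s q\<close>: the hedge \<open>v\<close>, with holes taken from the store \<open>S\<close>, is the result of
  decomposing \<open>s\<close> and \<open>q\<close> as far as possible, aligning them position by position from the left.
\<close>

inductive cdec :: "atom set \<Rightarrow> ctx \<Rightarrow> 'f aup set \<Rightarrow> 'f hedge \<Rightarrow> 'f hedge \<Rightarrow> 'f hedge \<Rightarrow> bool"
  for A \<Delta> S where
  cdec_Nil: "cdec A \<Delta> S [] [] []"
| cdec_left: "hole A \<Delta> S \<pi> Z [t] [] \<Longrightarrow> cdec A \<Delta> S v s [] \<Longrightarrow>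
    cdec A \<Delta> S (Susp \<pi> Z # v) (t # s) []"
| cdec_right: "hole A \<Delta> S \<pi> Z [] [t] \<Longrightarrow> cdec A \<Delta> S v [] q \<Longrightarrow>
    cdec A \<Delta> S (Susp \<pi> Z # v) [] (t # q)"
| cdec_stuck: "stuck A \<Delta> t1 t2 \<Longrightarrow> hole A \<Delta> S \<pi> Z [t1] [t2] \<Longrightarrow> cdec A \<Delta> S v s q \<Longrightarrow>
    cdec A \<Delta> S (Susp \<pi> Z # v) (t1 # s) (t2 # q)"
| cdec_Atom: "cdec A \<Delta> S v s q \<Longrightarrow> cdec A \<Delta> S (Atom a # v) (Atom a # s) (Atom a # q)"
| cdec_Abs: "abs_atom A \<Delta> (Abs a s1) (Abs b q1) c \<Longrightarrow>
    cdec A \<Delta> S w (act_hedge \<langle>c \<leftrightarrow> a\<rangle> s1) (act_hedge \<langle>c \<leftrightarrow> b\<rangle> q1) \<Longrightarrow> cdec A \<Delta> S v s q \<Longrightarrow>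
    cdec A \<Delta> S (Abs c w # v) (Abs a s1 # s) (Abs b q1 # q)"
| cdec_Fun: "cdec A \<Delta> S w s1 q1 \<Longrightarrow> cdec A \<Delta> S v s q \<Longrightarrow>
    cdec A \<Delta> S (Fun f w # v) (Fun f s1 # s) (Fun f q1 # q)"

inductive_cases cdec_Nil_NilE: "cdec A \<Delta> S v [] []"
inductive_cases cdec_Cons_NilE: "cdec A \<Delta> S v (t # s) []"
inductive_cases cdec_Nil_ConsE: "cdec A \<Delta> S v [] (t # q)"
inductive_cases cdec_Cons_ConsE: "cdec A \<Delta> S v (t1 # s) (t2 # q)"

text \<open>The condition on individual variables is preserved because only \<open>Nar_T\<close>
  introduces them.\<close>

definition store_ok :: "'f aup set \<Rightarrow> bool" where
  "store_ok S \<longleftrightarrow> finite S \<and> inj_on fst S \<and> (\<forall>(\<chi>, l, r)\<in>S. wf_hedge l \<and> wf_hedge r \<and>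
    (\<forall>x. \<chi> = IV x \<longrightarrow> (\<exists>t1 t2. l = [t1] \<and> r = [t2] \<and> wf_iterm t1 \<and> wf_iterm t2)))"

text \<open>Expresses that \<open>Mer\<close> and \<open>Nar_T\<close> are exhausted, leaving out
  the restriction of \<open>Mer\<close> on the kinds of the variables;
  \<open>terminal_saturated\<close> shows that final stores satisfy this stronger form.\<close>

definition saturated :: "atom set \<Rightarrow> ctx \<Rightarrow> 'f aup set \<Rightarrow> bool" where
  "saturated A \<Delta> S \<longleftrightarrow> store_ok S \<and>
    (\<forall>\<chi>1 l1 r1 \<chi>2 l2 r2 \<pi>. (\<chi>1, l1, r1) \<in> S \<longrightarrow> (\<chi>2, l2, r2) \<in> S \<longrightarrow> based_perm A \<pi> \<longrightarrow>
      equiv_hedge \<Delta> (act_hedge \<pi> l1) l2 \<longrightarrow> equiv_hedge \<Delta> (act_hedge \<pi> r1) r2 \<longrightarrow>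
      (\<chi>1, l1, r1) = (\<chi>2, l2, r2)) \<and>
    (\<forall>X t1 t2. (HV X, [t1], [t2]) \<in> S \<longrightarrow> \<not> (wf_iterm t1 \<and> wf_iterm t2))"

text \<open>In the derivations constructed below the freshness context always is this function of
  the store.\<close>

definition sctx :: "atom set \<Rightarrow> ctx \<Rightarrow> 'f aup set \<Rightarrow> ctx" where
  "sctx A \<Delta> S = (\<Union>(\<chi>, l, r)\<in>S. store_ctx A \<Delta> \<chi> l r)"

lemma store_okD:
  assumes "store_ok S"
  shows "finite S"
    and "(\<chi>, l, r) \<in> S \<Longrightarrow> (\<chi>, l', r') \<in> S \<Longrightarrow> l = l' \<and> r = r'"
    and "(\<chi>, l, r) \<in> S \<Longrightarrow> wf_hedge l \<and> wf_hedge r"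
    and "(IV x, l, r) \<in> S \<Longrightarrow> \<exists>t1 t2. l = [t1] \<and> r = [t2] \<and> wf_iterm t1 \<and> wf_iterm t2"
  using assms inj_onD[of fst S "(\<chi>, l, r)" "(\<chi>, l', r')"] by (auto simp: store_ok_def)

lemma in_sctx_iff:
  "(a, \<chi>) \<in> sctx A \<Delta> S \<longleftrightarrow>
    (\<exists>l r. (\<chi>, l, r) \<in> S \<and> a \<in> A \<and> fresh_hedge \<Delta> a l \<and> fresh_hedge \<Delta> a r)"
  by (auto simp: sctx_def store_ctx_def)

section \<open>Decompositions under permutations and equivalence\<close>

lemma abs_atom_act:
  assumes "based_perm A \<pi>"
  shows "abs_atom A \<Delta> (act \<pi> t1) (act \<pi> t2) (\<pi> \<langle>$\<rangle> c) \<longleftrightarrow> abs_atom A \<Delta> t1 t2 c"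
  by (simp add: abs_atom_def based_perm_apply[OF assms] fresh_act)

lemma abs_atom_equiv:
  "equiv_elem \<Delta> t1 t1' \<Longrightarrow> equiv_elem \<Delta> t2 t2' \<Longrightarrow> abs_atom A \<Delta> t1 t2 c \<longleftrightarrow> abs_atom A \<Delta> t1' t2' c"
  by (simp add: abs_atom_def equiv_fresh)

lemma stuck_equiv:
  "equiv_elem \<Delta> t1 t1' \<Longrightarrow> equiv_elem \<Delta> t2 t2' \<Longrightarrow> stuck A \<Delta> t1 t2 \<longleftrightarrow> stuck A \<Delta> t1' t2'"
  using abs_atom_equiv[of \<Delta> t1 t1' t2 t2' A] head_equiv[of \<Delta> t1 t1'] head_equiv[of \<Delta> t2 t2']
  by (simp add: stuck_def is_susp_head)

lemma head_act_eq_HdAbs [simp]: "head (act \<pi> t) = HdAbs \<longleftrightarrow> head t = HdAbs"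
  by (cases t) auto

lemma stuck_act:
  assumes "based_perm A \<pi>"
  shows "stuck A \<Delta> (act \<pi> t1) (act \<pi> t2) \<longleftrightarrow> stuck A \<Delta> t1 t2"
proof -
  have "(\<exists>c. abs_atom A \<Delta> (act \<pi> t1) (act \<pi> t2) c) \<longleftrightarrow> (\<exists>c. abs_atom A \<Delta> t1 t2 c)"
    by (metis abs_atom_act[OF assms] apply_apply_inverse)
  then show ?thesis by (simp add: stuck_def head_act_inj)
qed

lemma hole_act:
  "based_perm A \<pi> \<Longrightarrow> hole A \<Delta> S \<rho> Z s q \<Longrightarrow> hole A \<Delta> S (\<pi> * \<rho>) Z (act_hedge \<pi> s) (act_hedge \<pi> q)"
  unfolding hole_def by (metis act_hedge_mult based_perm_mult equiv_hedge_act)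

text \<open>The permutation has to be \<open>A\<close>-based so that the composed permutations of
  the holes stay \<open>A\<close>-based and the moved bound atoms stay in \<open>A\<close>.\<close>

lemma cdec_act:
  assumes "cdec A \<Delta> S v s q" and \<pi>: "based_perm A \<pi>"
  shows "cdec A \<Delta> S (act_hedge \<pi> v) (act_hedge \<pi> s) (act_hedge \<pi> q)"
  using assms(1)
proof induction
  case (cdec_left \<rho> Z t v s)
  then show ?case using hole_act[OF \<pi>, of \<Delta> S \<rho> Z "[t]" "[]"] by (auto intro: cdec.cdec_left)
next
  case (cdec_right \<rho> Z t v s)
  then show ?case using hole_act[OF \<pi>, of \<Delta> S \<rho> Z "[]" "[t]"] by (auto intro: cdec.cdec_right)
next
  case (cdec_stuck t1 t2 \<rho> Z v s q)
  then show ?case using hole_act[OF \<pi>, of \<Delta> S \<rho> Z "[t1]" "[t2]"]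
    by (auto intro: cdec.cdec_stuck simp: stuck_act[OF \<pi>])
next
  case (cdec_Abs a s1 b q1 c w v s q)
  have "abs_atom A \<Delta> (Abs (\<pi> \<langle>$\<rangle> a) (act_hedge \<pi> s1)) (Abs (\<pi> \<langle>$\<rangle> b) (act_hedge \<pi> q1)) (\<pi> \<langle>$\<rangle> c)"
    using cdec_Abs.hyps(1) abs_atom_act[OF \<pi>, of \<Delta> "Abs a s1" "Abs b q1" c] by simp
  then show ?case using cdec_Abs.IH by (auto intro!: cdec.cdec_Abs simp: mult_swap)
qed (auto intro: cdec.intros)

text \<open>The store records every atom of \<open>A\<close> that is fresh for both sides, so freshness lifts.\<close>

lemma hole_fresh:
  assumes "hole A \<Delta> S \<pi> Z s q" "c \<in> A" "fresh_hedge \<Delta> c s" "fresh_hedge \<Delta> c q"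
  shows "(inverse \<pi> \<langle>$\<rangle> c, Z) \<in> sctx A \<Delta> S"
  using assms unfolding hole_def in_sctx_iff
  by (metis based_perm_apply based_perm_inverse equiv_hedge_fresh fresh_hedge_act)

lemma cdec_fresh:
  assumes "cdec A \<Delta> S v s q" "c \<in> A" "fresh_hedge \<Delta> c s" "fresh_hedge \<Delta> c q"
  shows "fresh_hedge (sctx A \<Delta> S) c v"
  using assms
proof induction
  case (cdec_Abs a s1 b q1 d w v s q)
  \<comment> \<open>Renaming the bound atom to \<open>d\<close> keeps the freshness of
    \<open>c\<close>, so either \<open>c = d\<close> or \<open>c\<close> is fresh for both renamed
    bodies, as the induction hypothesis requires.\<close>
  have "fresh \<Delta> c (Abs d (act_hedge \<langle>d \<leftrightarrow> a\<rangle> s1))" "fresh \<Delta> c (Abs d (act_hedge \<langle>d \<leftrightarrow> b\<rangle> q1))"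
    using equiv_fresh[OF equiv_Abs_rename] cdec_Abs.prems cdec_Abs.hyps(1)
    unfolding abs_atom_def by (metis fresh_hedge_simps(2))+
  then show ?case using cdec_Abs by auto
qed (auto dest: hole_fresh)

text \<open>Composing one hole with the inverse of the other relates the two stored problems by an
  \<open>A\<close>-based permutation, so saturation makes them the same entry. The permutations then
  disagree only at atoms of \<open>A\<close> fresh for both its sides, which \<open>sctx\<close>
  records.\<close>

lemma hole_unique:
  assumes S: "saturated A \<Delta> S"
    and 1: "hole A \<Delta> S \<pi> Z s q" and 2: "hole A \<Delta> S \<pi>' Z' s' q'"
    and eq: "equiv_hedge \<Delta> s s'" "equiv_hedge \<Delta> q q'"
  shows "equiv_elem (sctx A \<Delta> S) (Susp \<pi> Z) (Susp \<pi>' Z')"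
proof -
  from 1 obtain l r where lr: "(Z, l, r) \<in> S" "equiv_hedge \<Delta> (act_hedge \<pi> l) s" "equiv_hedge \<Delta> (act_hedge \<pi> r) q"
    and \<pi>: "based_perm A \<pi>" unfolding hole_def by blast
  from 2 obtain l' r' where lr': "(Z', l', r') \<in> S" "equiv_hedge \<Delta> (act_hedge \<pi>' l') s'" "equiv_hedge \<Delta> (act_hedge \<pi>' r') q'"
    and \<pi>': "based_perm A \<pi>'" unfolding hole_def by blast
  have l: "equiv_hedge \<Delta> (act_hedge \<pi> l) (act_hedge \<pi>' l')"
    and r: "equiv_hedge \<Delta> (act_hedge \<pi> r) (act_hedge \<pi>' r')"
    using lr lr' eq by (meson equiv_hedge_sym equiv_hedge_trans)+
  have "equiv_hedge \<Delta> (act_hedge (inverse \<pi>' * \<pi>) l) l'" "equiv_hedge \<Delta> (act_hedge (inverse \<pi>' * \<pi>) r) r'"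
    using equiv_hedge_act[OF l, of "inverse \<pi>'"] equiv_hedge_act[OF r, of "inverse \<pi>'"] by simp_all
  moreover have "based_perm A (inverse \<pi>' * \<pi>)" using \<pi> \<pi>' by (simp add: based_perm_mult)
  ultimately have same: "Z' = Z" "l' = l" "r' = r"
    using S lr(1) lr'(1) unfolding saturated_def by blast+
  have "(a, Z) \<in> sctx A \<Delta> S" if "\<pi> \<langle>$\<rangle> a \<noteq> \<pi>' \<langle>$\<rangle> a" for a
  proof -
    have "a \<in> A" using that \<pi> \<pi>' unfolding based_perm_def by (metis in_affected subsetD)
    moreover have "fresh_hedge \<Delta> a l" "fresh_hedge \<Delta> a r"
      using l r that unfolding same equiv_act_act_iff by blast+
    ultimately show ?thesis using lr(1) by (auto simp: in_sctx_iff)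
  qed
  then show ?thesis by (auto simp: same equiv_Susp_iff)
qed

lemma not_stuck [simp]:
  "\<not> stuck A \<Delta> (Atom a) (Atom a)"
  "\<not> stuck A \<Delta> (Fun f s) (Fun f q)"
  by (simp_all add: stuck_def)

lemma not_stuck_Abs: "abs_atom A \<Delta> (Abs a s) (Abs b q) c \<Longrightarrow> \<not> stuck A \<Delta> (Abs a s) (Abs b q)"
  by (auto simp: stuck_def)

text \<open>Equivalence preserves heads, admissible bound atoms and being stuck, so both derivations
  use the same rule at each position. Freedom remains only in the holes, settled by
  \<open>hole_unique\<close>, and in the bound atoms of abstractions.\<close>

lemma cdec_unique:
  assumes "cdec A \<Delta> S v s q" and "saturated A \<Delta> S"
    and "cdec A \<Delta> S v' s' q'" and "equiv_hedge \<Delta> s s'" and "equiv_hedge \<Delta> q q'"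
  shows "equiv_hedge (sctx A \<Delta> S) v v'"
  using assms(1,3-)
proof (induction arbitrary: v' s' q')
  case cdec_Nil
  then show ?case by (auto elim: cdec_Nil_NilE)
next
  case (cdec_left \<pi> Z t v s)
  from cdec_left.prems obtain t' s1 where eq: "s' = t' # s1" "q' = []" "equiv_elem \<Delta> t t'" "equiv_hedge \<Delta> s s1"
    by (auto simp: equiv_hedge_Cons1)
  from cdec_left.prems(1)[unfolded eq] obtain \<pi>' Z' v1 where
    "v' = Susp \<pi>' Z' # v1" "hole A \<Delta> S \<pi>' Z' [t'] []" "cdec A \<Delta> S v1 s1 []"
    by (rule cdec_Cons_NilE)
  then show ?case using cdec_left.IH eq hole_unique[OF assms(2) cdec_left.hyps(1), of \<pi>' Z' "[t']" "[]"] by auto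
next
  case (cdec_right \<pi> Z t v q)
  from cdec_right.prems obtain t' q1 where eq: "q' = t' # q1" "s' = []" "equiv_elem \<Delta> t t'" "equiv_hedge \<Delta> q q1"
    by (auto simp: equiv_hedge_Cons1)
  from cdec_right.prems(1)[unfolded eq] obtain \<pi>' Z' v1 where
    "v' = Susp \<pi>' Z' # v1" "hole A \<Delta> S \<pi>' Z' [] [t']" "cdec A \<Delta> S v1 [] q1"
    by (rule cdec_Nil_ConsE)
  then show ?case using cdec_right.IH eq hole_unique[OF assms(2) cdec_right.hyps(1), of \<pi>' Z' "[]" "[t']"] by auto
next
  case (cdec_stuck t1 t2 \<pi> Z v s q)
  from cdec_stuck.prems obtain t1' s1 t2' q1 where eq: "s' = t1' # s1" "q' = t2' # q1"
      "equiv_elem \<Delta> t1 t1'" "equiv_elem \<Delta> t2 t2'" "equiv_hedge \<Delta> s s1" "equiv_hedge \<Delta> q q1"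
    by (auto simp: equiv_hedge_Cons1)
  have st: "stuck A \<Delta> t1' t2'" using stuck_equiv[OF eq(3,4)] cdec_stuck.hyps(1) by blast
  from cdec_stuck.prems(1)[unfolded eq] obtain \<pi>' Z' v1 where
    "v' = Susp \<pi>' Z' # v1" "hole A \<Delta> S \<pi>' Z' [t1'] [t2']" "cdec A \<Delta> S v1 s1 q1"
    by (rule cdec_Cons_ConsE) (use st in \<open>auto dest: not_stuck_Abs\<close>)
  then show ?case using cdec_stuck.IH eq hole_unique[OF assms(2) cdec_stuck.hyps(2), of \<pi>' Z' "[t1']" "[t2']"] by auto
next
  case (cdec_Atom v s q a)
  from cdec_Atom.prems obtain s1 q1 where eq: "s' = Atom a # s1" "q' = Atom a # q1"
      "equiv_hedge \<Delta> s s1" "equiv_hedge \<Delta> q q1"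
    by (auto simp: equiv_hedge_Cons1)
  from cdec_Atom.prems(1)[unfolded eq] obtain v1 where "v' = Atom a # v1" "cdec A \<Delta> S v1 s1 q1"
    by (rule cdec_Cons_ConsE) auto
  then show ?case using cdec_Atom.IH eq by auto
next
  case (cdec_Fun w s1 q1 v s q f)
  from cdec_Fun.prems obtain s2 s3 q2 q3 where eq: "s' = Fun f s2 # s3" "q' = Fun f q2 # q3"
      "equiv_hedge \<Delta> s1 s2" "equiv_hedge \<Delta> q1 q2" "equiv_hedge \<Delta> s s3" "equiv_hedge \<Delta> q q3"
    by (auto simp: equiv_hedge_Cons1 equiv_Fun_iff)
  from cdec_Fun.prems(1)[unfolded eq] obtain w1 v1 where
    "v' = Fun f w1 # v1" "cdec A \<Delta> S v1 s3 q3" "cdec A \<Delta> S w1 s2 q2"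
    by (rule cdec_Cons_ConsE) auto
  then show ?case using cdec_Fun.IH eq by (auto simp: equiv_Fun_iff)
next
  case (cdec_Abs a s1 b q1 c w v s q)
  from cdec_Abs.prems obtain a' s2 s3 b' q2 q3 where eq: "s' = Abs a' s2 # s3" "q' = Abs b' q2 # q3"
      "equiv_elem \<Delta> (Abs a s1) (Abs a' s2)" "equiv_elem \<Delta> (Abs b q1) (Abs b' q2)"
      "equiv_hedge \<Delta> s s3" "equiv_hedge \<Delta> q q3"
    by (auto simp: equiv_hedge_Cons1) (auto simp: equiv_Abs_iff)
  have "abs_atom A \<Delta> (Abs a' s2) (Abs b' q2) c"
    using abs_atom_equiv[OF eq(3,4)] cdec_Abs.hyps(1) by blast
  then have nst: "\<not> stuck A \<Delta> (Abs a' s2) (Abs b' q2)" by (rule not_stuck_Abs)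
  from cdec_Abs.prems(1)[unfolded eq] obtain d w1 v1 where v':
    "v' = Abs d w1 # v1" "cdec A \<Delta> S v1 s3 q3"
    and d: "abs_atom A \<Delta> (Abs a' s2) (Abs b' q2) d"
    and w1: "cdec A \<Delta> S w1 (act_hedge \<langle>d \<leftrightarrow> a'\<rangle> s2) (act_hedge \<langle>d \<leftrightarrow> b'\<rangle> q2)"
    by (rule cdec_Cons_ConsE) (use nst in auto)
  have c: "c \<in> A" "d \<in> A" using cdec_Abs.hyps(1) d by (auto simp: abs_atom_def)
  have s: "equiv_elem \<Delta> (Abs c (act_hedge \<langle>c \<leftrightarrow> a\<rangle> s1)) (Abs d (act_hedge \<langle>d \<leftrightarrow> a'\<rangle> s2))"
    and q: "equiv_elem \<Delta> (Abs c (act_hedge \<langle>c \<leftrightarrow> b\<rangle> q1)) (Abs d (act_hedge \<langle>d \<leftrightarrow> b'\<rangle> q2))"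
    using eq(3,4) d cdec_Abs.hyps(1) unfolding abs_atom_def
    by (meson equiv_Abs_rename equiv_elem_sym equiv_elem_trans)+
  \<comment> \<open>Swapping renames the second bound atom \<open>d\<close> to \<open>c\<close>.
    Both lie in \<open>A\<close>, so the result is again a decomposition, now of problems equivalent
    to those of \<open>w\<close>.\<close>
  have "cdec A \<Delta> S (act_hedge \<langle>c \<leftrightarrow> d\<rangle> w1) (act_hedge \<langle>c \<leftrightarrow> d\<rangle> (act_hedge \<langle>d \<leftrightarrow> a'\<rangle> s2))
      (act_hedge \<langle>c \<leftrightarrow> d\<rangle> (act_hedge \<langle>d \<leftrightarrow> b'\<rangle> q2))"
    using w1 based_perm_swap[OF c] by (rule cdec_act)
  then have "equiv_hedge (sctx A \<Delta> S) w (act_hedge \<langle>c \<leftrightarrow> d\<rangle> w1)"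
    using cdec_Abs.IH(1) s q by (auto simp: equiv_Abs_iff)
  moreover have "c = d \<or> fresh_hedge (sctx A \<Delta> S) c w1"
    using cdec_fresh[OF w1 c(1)] s q by (auto simp: equiv_Abs_iff)
  moreover have "equiv_hedge (sctx A \<Delta> S) v v1"
    using cdec_Abs.IH(2) v' eq by blast
  ultimately show ?case by (auto simp: v' equiv_Abs_iff)
qed

text \<open>Equivalence keeps the kind of an element, so the stored problem behind the hole consists
  of two individual terms, and an exhaustively narrowed store keeps it under an individual
  variable.\<close>

lemma hole_wf_iterm:
  assumes S: "saturated A \<Delta> S" and "hole A \<Delta> S \<pi> Z [t1] [t2]" "wf_iterm t1" "wf_iterm t2"
  shows "wf_iterm (Susp \<pi> Z)"
proof -
  from assms(2) obtain l r where lr: "(Z, l, r) \<in> S" "equiv_hedge \<Delta> (act_hedge \<pi> l) [t1]" "equiv_hedge \<Delta> (act_hedge \<pi> r) [t2]"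
    unfolding hole_def by blast
  obtain t1' where l: "l = [t1']" "equiv_elem \<Delta> (act \<pi> t1') t1"
    using lr(2) by (cases l) auto
  obtain t2' where r: "r = [t2']" "equiv_elem \<Delta> (act \<pi> t2') t2"
    using lr(3) by (cases r) auto
  have "wf_hedge l" "wf_hedge r" using S store_okD(3)[OF _ lr(1)] by (auto simp: saturated_def)
  then have "wf_iterm t1'" "wf_iterm t2'"
    using assms(3,4) is_hsusp_equiv[OF l(2)] is_hsusp_equiv[OF r(2)] by (auto simp: l r wf_iterm_def)
  then obtain x where "Z = IV x"
    using S lr(1) unfolding l r saturated_def by (cases Z) auto
  then show ?thesis by (simp add: wf_iterm_def)
qed

lemma cdec_wf:
  assumes "cdec A \<Delta> S v s q" and S: "saturated A \<Delta> S" and "wf_hedge s" "wf_hedge q"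
  shows "wf_hedge v"
    and "s = [t1] \<Longrightarrow> q = [t2] \<Longrightarrow> wf_iterm t1 \<Longrightarrow> wf_iterm t2 \<Longrightarrow> \<exists>t. v = [t] \<and> wf_iterm t"
proof -
  \<comment> \<open>Both claims share one induction, since well-formedness of an abstraction needs
    the second claim for its body.\<close>
  have "wf_hedge v \<and> (\<forall>t1 t2. s = [t1] \<longrightarrow> q = [t2] \<longrightarrow> wf_iterm t1 \<longrightarrow> wf_iterm t2 \<longrightarrow>
      (\<exists>t. v = [t] \<and> wf_iterm t))"
    using assms(1,3,4)
  proof induction
    case (cdec_stuck t1 t2 \<pi> Z v s q)
    then show ?case using hole_wf_iterm[OF S cdec_stuck.hyps(2)] by (auto elim: cdec_Nil_NilE)
  next
    case (cdec_Abs a s1 b q1 c w v s q)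
    then show ?case by (auto simp: wf_iterm_def elim: cdec_Nil_NilE)
  qed (auto simp: wf_iterm_def elim: cdec_Nil_NilE)
  then show "wf_hedge v"
    "s = [t1] \<Longrightarrow> q = [t2] \<Longrightarrow> wf_iterm t1 \<Longrightarrow> wf_iterm t2 \<Longrightarrow> \<exists>t. v = [t] \<and> wf_iterm t"
    by auto
qed

text \<open>
  \<open>gdec A \<Delta> S \<sigma>1 \<sigma>2 u v s q\<close>: the alignment follows the generalization \<open>u\<close> of \<open>s\<close> and \<open>q\<close>
  as far as its variables, and the instances of each variable are decomposed by \<open>cdec\<close>.
\<close>

inductive gdec :: "atom set \<Rightarrow> ctx \<Rightarrow> 'f aup set \<Rightarrow> 'f subst \<Rightarrow> 'f subst \<Rightarrow>
    'f hedge \<Rightarrow> 'f hedge \<Rightarrow> 'f hedge \<Rightarrow> 'f hedge \<Rightarrow> bool"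
  for A \<Delta> S \<sigma>1 \<sigma>2 where
  gdec_Nil: "gdec A \<Delta> S \<sigma>1 \<sigma>2 [] [] [] []"
| gdec_Atom: "gdec A \<Delta> S \<sigma>1 \<sigma>2 u v s q \<Longrightarrow>
    gdec A \<Delta> S \<sigma>1 \<sigma>2 (Atom a # u) (Atom a # v) (Atom a # s) (Atom a # q)"
| gdec_Susp: "cdec A \<Delta> S w s0 q0 \<Longrightarrow> based_perm A \<pi> \<Longrightarrow> wf_hedge s0 \<Longrightarrow> wf_hedge q0 \<Longrightarrow>
    equiv_hedge \<Delta> (act_hedge \<pi> (\<sigma>1 \<chi>)) s0 \<Longrightarrow> equiv_hedge \<Delta> (act_hedge \<pi> (\<sigma>2 \<chi>)) q0 \<Longrightarrow>
    gdec A \<Delta> S \<sigma>1 \<sigma>2 u v s q \<Longrightarrow>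
    gdec A \<Delta> S \<sigma>1 \<sigma>2 (Susp \<pi> \<chi> # u) (w @ v) (s0 @ s) (q0 @ q)"
| gdec_Abs: "gdec A \<Delta> S \<sigma>1 \<sigma>2 u1 w (act_hedge \<langle>c \<leftrightarrow> a\<rangle> s1) (act_hedge \<langle>c \<leftrightarrow> b\<rangle> q1) \<Longrightarrow>
    gdec A \<Delta> S \<sigma>1 \<sigma>2 u v s q \<Longrightarrow>
    gdec A \<Delta> S \<sigma>1 \<sigma>2 (Abs c u1 # u) (Abs c w # v) (Abs a s1 # s) (Abs b q1 # q)"
| gdec_Fun: "gdec A \<Delta> S \<sigma>1 \<sigma>2 u1 w s1 q1 \<Longrightarrow> gdec A \<Delta> S \<sigma>1 \<sigma>2 u v s q \<Longrightarrow>
    gdec A \<Delta> S \<sigma>1 \<sigma>2 (Fun f u1 # u) (Fun f w # v) (Fun f s1 # s) (Fun f q1 # q)"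

text \<open>The sides are taken up to equivalence because the occurrences met in \<open>gdec\<close>
  agree with the permuted instances only up to it.\<close>

definition inst_dec :: "atom set \<Rightarrow> ctx \<Rightarrow> 'f aup set \<Rightarrow> 'f subst \<Rightarrow> 'f subst \<Rightarrow> var \<Rightarrow> 'f hedge \<Rightarrow> bool" where
  "inst_dec A \<Delta> S \<sigma>1 \<sigma>2 \<chi> w \<longleftrightarrow> (\<exists>s q. cdec A \<Delta> S w s q \<and> wf_hedge s \<and> wf_hedge q \<and>
    equiv_hedge \<Delta> (\<sigma>1 \<chi>) s \<and> equiv_hedge \<Delta> (\<sigma>2 \<chi>) q)"

text \<open>Undoing the permutation of one occurrence of \<chi> gives a decomposition of the bare
  instances of \<chi>, by \<open>cdec_act\<close>.\<close>

lemma gdec_vars: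
  "gdec A \<Delta> S \<sigma>1 \<sigma>2 u v s q \<Longrightarrow> \<chi> \<in> vars_hedge u \<Longrightarrow> \<exists>w. inst_dec A \<Delta> S \<sigma>1 \<sigma>2 \<chi> w"
proof (induction rule: gdec.induct)
  case (gdec_Susp w s0 q0 \<pi> \<chi>' u v s q)
  have "inst_dec A \<Delta> S \<sigma>1 \<sigma>2 \<chi>' (act_hedge (inverse \<pi>) w)"
    unfolding inst_dec_def
    using cdec_act[OF gdec_Susp.hyps(1), of "inverse \<pi>"] gdec_Susp.hyps
    by (intro exI[of _ "act_hedge (inverse \<pi>) s0"] exI[of _ "act_hedge (inverse \<pi>) q0"])
      (simp add: equiv_hedge_act_left)
  then show ?case using gdec_Susp by auto
qed auto

text \<open>At each occurrence the permuted value of \<chi> and the piece present in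
  \<open>v\<close> decompose equivalent problems, so \<open>cdec_unique\<close> identifies them. One
  value thus serves all occurrences.\<close>

lemma gdec_subst:
  assumes "gdec A \<Delta> S \<sigma>1 \<sigma>2 u v s q" and "saturated A \<Delta> S"
    and "\<And>\<chi>. \<chi> \<in> vars_hedge u \<Longrightarrow> inst_dec A \<Delta> S \<sigma>1 \<sigma>2 \<chi> (\<theta> \<chi>)"
  shows "equiv_hedge (sctx A \<Delta> S) (subst_hedge \<theta> u) v"
  using assms(1,3)
proof induction
  case (gdec_Susp w s0 q0 \<pi> \<chi> u v s q)
  obtain s' q' where *: "cdec A \<Delta> S (\<theta> \<chi>) s' q'" "equiv_hedge \<Delta> (\<sigma>1 \<chi>) s'" "equiv_hedge \<Delta> (\<sigma>2 \<chi>) q'"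
    using gdec_Susp.prems[of \<chi>] unfolding inst_dec_def by auto
  have "equiv_hedge \<Delta> (act_hedge \<pi> s') s0" "equiv_hedge \<Delta> (act_hedge \<pi> q') q0"
    using *(2,3) gdec_Susp.hyps(5,6) by (meson equiv_hedge_act equiv_hedge_sym equiv_hedge_trans)+
  then have "equiv_hedge (sctx A \<Delta> S) (act_hedge \<pi> (\<theta> \<chi>)) w"
    using cdec_unique[OF cdec_act[OF *(1) gdec_Susp.hyps(2)] assms(2) gdec_Susp.hyps(1)] by blast
  then show ?case using gdec_Susp by (auto intro: equiv_hedge_append)
qed (auto simp: equiv_Abs_same_iff equiv_Fun_iff)

section \<open>The substitution that instantiates the generalization\<close>

lemma infinite_atom: "infinite (UNIV :: atom set)"
proof -
  have "inj Atm" by (auto intro: injI)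
  then show ?thesis using infinite_iff_countable_subset by blast
qed

lemma finite_sctx: "finite A \<Longrightarrow> finite S \<Longrightarrow> finite (sctx A \<Delta> S)"
  unfolding sctx_def store_ctx_def by auto

lemma finite_vars_hedge [simp]: "finite (vars_hedge s)"
  by (induction s rule: hedge_induct) auto

text \<open>Each variable of \<open>u\<close> is sent to a decomposition of its two instances.
  \<open>cdec_wf\<close> makes this a substitution, \<open>cdec_fresh\<close> lets it respect \<Xi>,
  whose atoms lie in \<open>A\<close>, and \<open>gdec_subst\<close> gives the equivalence.\<close>

lemma more_general_gdec:
  assumes A: "finite A" and S: "saturated A \<Delta> S"
    and dec: "gdec A \<Delta> S \<sigma>1 \<sigma>2 u v s q"
    and \<Xi>: "finite \<Xi>" "based_ctx A \<Xi>"
    and subst: "is_subst \<sigma>1" "is_subst \<sigma>2"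
    and fresh: "\<And>a \<chi>. (a, \<chi>) \<in> \<Xi> \<Longrightarrow> fresh_hedge \<Delta> a (\<sigma>1 \<chi>)" "\<And>a \<chi>. (a, \<chi>) \<in> \<Xi> \<Longrightarrow> fresh_hedge \<Delta> a (\<sigma>2 \<chi>)"
  shows "more_general (\<Xi>, u) (sctx A \<Delta> S, v)"
proof -
  \<comment> \<open>\<open>Atom b\<close> is an individual term that satisfies every constraint with
    an atom of \<open>A\<close>. It serves the variables constrained in \<Xi> but absent from
    \<open>u\<close>. All further variables stay fixed, which keeps the domain finite.\<close>
  obtain b where b: "b \<notin> A" using A infinite_atom ex_new_if_finite by blast
  define \<theta> where "\<theta> = (\<lambda>\<chi>. if \<chi> \<in> vars_hedge u then SOME w. inst_dec A \<Delta> S \<sigma>1 \<sigma>2 \<chi> w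
    else if \<chi> \<in> vars_ctx \<Xi> then [Atom b] else [Susp 1 \<chi>])"
  have \<theta>: "inst_dec A \<Delta> S \<sigma>1 \<sigma>2 \<chi> (\<theta> \<chi>)" if "\<chi> \<in> vars_hedge u" for \<chi>
    using someI_ex[OF gdec_vars[OF dec that]] that by (simp add: \<theta>_def)
  have IV: "\<exists>t. \<theta> (IV x) = [t] \<and> wf_iterm t" for x
  proof (cases "IV x \<in> vars_hedge u")
    case True
    obtain s q where *: "cdec A \<Delta> S (\<theta> (IV x)) s q" "wf_hedge s" "wf_hedge q"
      "equiv_hedge \<Delta> (\<sigma>1 (IV x)) s" "equiv_hedge \<Delta> (\<sigma>2 (IV x)) q"
      using \<theta>[OF True] unfolding inst_dec_def by blast
    obtain t1 t2 where "\<sigma>1 (IV x) = [t1]" "wf_iterm t1" "\<sigma>2 (IV x) = [t2]" "wf_iterm t2"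
      using subst unfolding is_subst_def by metis
    then obtain t1' t2' where "s = [t1']" "q = [t2']" "wf_iterm t1'" "wf_iterm t2'"
      using *(2-) by (auto simp: equiv_hedge_Cons1 wf_iterm_def is_hsusp_equiv)
    then show ?thesis using cdec_wf(2)[OF *(1) S *(2,3)] by blast
  next
    case False
    then show ?thesis by (auto simp: \<theta>_def wf_iterm_def)
  qed
  have HV: "wf_hedge (\<theta> (HV X))" for X
  proof (cases "HV X \<in> vars_hedge u")
    case True
    then show ?thesis using \<theta>[OF True] cdec_wf(1)[OF _ S] unfolding inst_dec_def by blast
  next
    case False
    then show ?thesis by (auto simp: \<theta>_def)
  qed
  have "dom_subst \<theta> \<subseteq> vars_hedge u \<union> vars_ctx \<Xi>"
    by (auto simp: dom_subst_def \<theta>_def split: if_splits)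
  then have "finite (dom_subst \<theta>)"
    by (rule finite_subset) (use \<Xi> in \<open>simp add: vars_ctx_def\<close>)
  then have "is_subst \<theta>" using IV HV by (simp add: is_subst_def)
  moreover have "fresh_hedge (sctx A \<Delta> S) a (\<theta> \<chi>)" if "(a, \<chi>) \<in> \<Xi>" for a \<chi>
  proof -
    have a: "a \<in> A" using that \<Xi>(2) by (force simp: based_ctx_def atoms_ctx_def)
    show ?thesis
    proof (cases "\<chi> \<in> vars_hedge u")
      case True
      then show ?thesis
        using \<theta>[OF True] fresh[OF that] cdec_fresh[OF _ a] equiv_hedge_fresh unfolding inst_dec_def by metis
    next
      case False
      moreover have "\<chi> \<in> vars_ctx \<Xi>" using that by (force simp: vars_ctx_def)
      ultimately show ?thesis using a b by (auto simp: \<theta>_def)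
    qed
  qed
  moreover have "equiv_hedge (sctx A \<Delta> S) (subst_hedge \<theta> u) v"
    using dec S \<theta> by (rule gdec_subst)
  ultimately show ?thesis
    using A S by (subst more_general_iff) (auto simp: saturated_def store_ok_def finite_sctx)
qed

section \<open>Running the algorithm\<close>

lemma hvars_avoiding:
  assumes "finite F"
  shows "\<exists>Ys. length Ys = n \<and> distinct Ys \<and> (\<forall>Y\<in>set Ys. HV Y \<notin> F)"
proof -
  have "inj (\<lambda>n. HV (HVar n))" by (auto intro: injI)
  then have "infinite (HV ` UNIV)"
    by (metis (no_types, lifting) finite_imageD finite_subset image_subsetI infinite_UNIV_nat rangeI)
  then have "infinite (HV ` UNIV - F)" using assms by (rule Diff_infinite_finite[rotated])
  then obtain B where B: "B \<subseteq> HV ` UNIV - F" "card B = n" "finite B"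
    using infinite_arbitrarily_large by blast
  obtain ys where ys: "set ys = B" "distinct ys" using B(3) finite_distinct_list by blast
  define Ys where "Ys = map (\<lambda>\<chi>. case \<chi> of HV Y \<Rightarrow> Y) ys"
  have "map HV Ys = ys" using B(1) ys(1) unfolding Ys_def by (auto simp: comp_def intro!: map_idI)
  then show ?thesis using ys B
    by (intro exI[of _ Ys]) (auto simp: distinct_map dest: arg_cong[where f = set] arg_cong[where f = length] distinct_card)
qed

lemma ivar_avoiding:
  assumes "finite F"
  shows "\<exists>x. IV x \<notin> F"
proof -
  have "inj (\<lambda>n. IV (IVar n))" by (auto intro: injI)
  then have "infinite (range (\<lambda>n. IV (IVar n)))" by (simp add: finite_image_iff)
  then obtain \<chi> where "\<chi> \<in> range (\<lambda>n. IV (IVar n))" "\<chi> \<notin> F"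
    by (meson assms rev_finite_subset subsetI)
  then show ?thesis by auto
qed

lemma finite_vars_aups: "finite P \<Longrightarrow> finite (vars_aups P)"
  by (auto simp: vars_aups_def)

lemma finite_vars_state:
  "finite P \<Longrightarrow> finite S \<Longrightarrow> finite \<Gamma> \<Longrightarrow> finite (dom_subst \<sigma>) \<Longrightarrow> finite (vars_state (P, S, \<Gamma>, \<sigma>))"
  by (simp add: finite_vars_aups vars_ctx_def vars_subst_def)

lemma finite_dom_subst_upd: "finite (dom_subst \<sigma>) \<Longrightarrow> finite (dom_subst (subst_upd \<sigma> \<chi> u))"
  by (rule finite_subset[of _ "insert \<chi> (dom_subst \<sigma>)"])
    (auto simp: dom_subst_def subst_upd_def single_def id_subst_def)

section \<open>Merging and narrowing the store\<close>

lemma sctx_insert: "sctx A \<Delta> (insert (\<chi>, l, r) S) = store_ctx A \<Delta> \<chi> l r \<union> sctx A \<Delta> S"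
  by (auto simp: sctx_def)

lemma sctx_empty [simp]: "sctx A \<Delta> {} = {}"
  by (simp add: sctx_def)

text \<open>Each constraint on \<open>\<chi>2\<close> holds of the suspension replacing it by virtue
  of exactly one constraint on \<open>\<chi>1\<close>, so the least context can be computed and
  compared with \<open>sctx\<close> of the new store.\<close>

lemma ctx_subst_single:
  assumes "finite \<Gamma>"
  shows "ctx_subst \<Gamma> (single \<chi>2 [Susp \<pi> \<chi>1] :: 'f subst) =
    {(a, \<chi>) \<in> \<Gamma>. \<chi> \<noteq> \<chi>2} \<union> (\<lambda>(a, \<chi>). (inverse \<pi> \<langle>$\<rangle> a, \<chi>1)) ` {(a, \<chi>) \<in> \<Gamma>. \<chi> = \<chi>2}" (is "_ = ?R")
  unfolding ctx_subst_def
proof (rule Least_equality)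
  have "finite ?R" using assms by (auto intro: rev_finite_subset)
  then show "ctx_instance_of \<Gamma> (single \<chi>2 [Susp \<pi> \<chi>1] :: 'f subst) ?R"
    unfolding ctx_instance_of_def single_def id_subst_def by force
next
  fix \<Gamma>' assume "ctx_instance_of \<Gamma> (single \<chi>2 [Susp \<pi> \<chi>1] :: 'f subst) \<Gamma>'"
  then show "?R \<subseteq> \<Gamma>'" unfolding ctx_instance_of_def single_def id_subst_def by (force split: if_splits)
qed

text \<open>Tracks stored variables through later steps: merging and narrowing replace them by
  suspensions only, and these remain holes for the original problems.\<close>

definition hole_subst :: "atom set \<Rightarrow> ctx \<Rightarrow> 'f aup set \<Rightarrow> 'f aup set \<Rightarrow> 'f subst \<Rightarrow> bool" where
  "hole_subst A \<Delta> S S' \<tau> \<longleftrightarrow>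
    (\<forall>\<chi> l r. (\<chi>, l, r) \<in> S \<longrightarrow> (\<exists>\<pi> Z. \<tau> \<chi> = [Susp \<pi> Z] \<and> hole A \<Delta> S' \<pi> Z l r))"

lemma hole_refl: "(\<chi>, l, r) \<in> S \<Longrightarrow> hole A \<Delta> S 1 \<chi> l r"
  unfolding hole_def by force

lemma hole_subst_comp:
  assumes "hole_subst A \<Delta> S S1 \<sigma>" and "hole_subst A \<Delta> S1 S2 \<tau>"
  shows "hole_subst A \<Delta> S S2 (comp_subst \<sigma> \<tau>)"
  unfolding hole_subst_def
proof (intro allI impI)
  fix \<chi> l r assume "(\<chi>, l, r) \<in> S"
  then obtain \<pi> Z l1 r1 where 1: "\<sigma> \<chi> = [Susp \<pi> Z]" "(Z, l1, r1) \<in> S1" "based_perm A \<pi>"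
      "equiv_hedge \<Delta> (act_hedge \<pi> l1) l" "equiv_hedge \<Delta> (act_hedge \<pi> r1) r"
    using assms(1) unfolding hole_subst_def hole_def by blast
  then obtain \<rho> Z' where 2: "\<tau> Z = [Susp \<rho> Z']" "hole A \<Delta> S2 \<rho> Z' l1 r1"
    using assms(2) unfolding hole_subst_def by blast
  have "hole A \<Delta> S2 (\<pi> * \<rho>) Z' l r"
    using hole_act[OF 1(3) 2(2)] 1(4,5) unfolding hole_def by (meson equiv_hedge_trans)
  then show "\<exists>\<pi> Z. comp_subst \<sigma> \<tau> \<chi> = [Susp \<pi> Z] \<and> hole A \<Delta> S2 \<pi> Z l r"
    using 1(1) 2(1) by (simp add: comp_subst_def)
qed

lemma hole_subst_id: "hole_subst A \<Delta> S S id_subst"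
  by (auto simp: hole_subst_def id_subst_def hole_refl)

text \<open>Termination measure: \<open>Mer\<close> lowers the first summand, while
  \<open>Nar_T\<close> keeps it and lowers the second by turning a hedge variable into an individual
  one.\<close>

definition store_size :: "'f aup set \<Rightarrow> nat" where
  "store_size S = card S + card {p \<in> S. \<exists>X. fst p = HV X}"

lemma merge_step:
  assumes step: "vnau A \<Delta> ({}, S, sctx A \<Delta> S, \<sigma>) st" and S: "store_ok S"
    and A: "finite A" and \<sigma>: "finite (dom_subst \<sigma>)"
  shows "\<exists>S1 \<tau>. st = ({}, S1, sctx A \<Delta> S1, comp_subst \<sigma> \<tau>) \<and> store_ok S1 \<and>
    store_size S1 < store_size S \<and> finite (dom_subst (comp_subst \<sigma> \<tau>)) \<and> hole_subst A \<Delta> S S1 \<tau>"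
  using step
proof cases
  case (Mer \<chi>1 l1 r1 \<chi>2 l2 r2 S0 \<pi>)
  let ?S1 = "insert (\<chi>1, l1, r1) S0" and ?\<tau> = "single \<chi>2 [Susp \<pi> \<chi>1] :: 'a subst"
  have fin: "finite S" using S by (rule store_okD)
  have S1: "S = insert (\<chi>2, l2, r2) ?S1" "(\<chi>2, l2, r2) \<notin> ?S1" using Mer by auto
  then have ok: "store_ok ?S1" using S unfolding store_ok_def by (auto intro: inj_on_subset)
  have new: "\<chi> \<noteq> \<chi>2" if "(\<chi>, l, r) \<in> ?S1" for \<chi> l r
    using store_okD(2)[OF S, of \<chi> l r l2 r2] that S1 by auto
  \<comment> \<open>A constraint moved from \<open>\<chi>2\<close> to \<open>\<chi>1\<close> is
    already present: \<pi> is \<open>A\<close>-based, so an atom of \<open>A\<close> fresh for the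
    deleted problem is carried to one in \<open>A\<close> fresh for the kept problem.\<close>
  have "ctx_subst (sctx A \<Delta> S) ?\<tau> = sctx A \<Delta> ?S1"
  proof -
    have "(a, \<chi>) \<in> sctx A \<Delta> ?S1 \<longleftrightarrow> (a, \<chi>) \<in> sctx A \<Delta> S \<and> \<chi> \<noteq> \<chi>2" for a \<chi>
      unfolding in_sctx_iff S1(1) using new by blast
    moreover have "(inverse \<pi> \<langle>$\<rangle> a, \<chi>1) \<in> sctx A \<Delta> ?S1" if "(a, \<chi>2) \<in> sctx A \<Delta> S" for a
    proof -
      have "a \<in> A" "fresh_hedge \<Delta> a l2" "fresh_hedge \<Delta> a r2"
        using that new unfolding in_sctx_iff S1(1) by blast+
      then show ?thesis
        using Mer(7-9) hole_fresh[of A \<Delta> ?S1 \<pi> \<chi>1 l2 r2 a] by (auto simp: hole_def)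
    qed
    ultimately show ?thesis
      using ctx_subst_single[OF finite_sctx[OF A fin], of \<Delta> \<chi>2 \<pi> \<chi>1] by fastforce
  qed
  moreover have "store_size ?S1 < store_size S"
  proof -
    have "finite ?S1" using fin S1 by simp
    then have "card S = Suc (card ?S1)" using S1 by simp
    moreover have "card {p \<in> ?S1. \<exists>X. fst p = HV X} \<le> card {p \<in> S. \<exists>X. fst p = HV X}"
      using fin S1(1) by (intro card_mono) auto
    ultimately show ?thesis unfolding store_size_def by simp
  qed
  moreover have "hole A \<Delta> ?S1 \<pi> \<chi>1 l2 r2"
    using Mer(7-9) unfolding hole_def by blast
  then have "hole_subst A \<Delta> S ?S1 ?\<tau>"
    using new hole_refl[of _ _ _ ?S1] unfolding hole_subst_def S1(1) single_def id_subst_def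
    by (auto simp del: insert_iff) (auto simp: hole_refl)
  ultimately show ?thesis
    using Mer(2) ok finite_dom_subst_upd[OF \<sigma>] S1(1)
    by (intro exI[of _ ?S1] exI[of _ ?\<tau>]) (auto simp: subst_upd_eq_comp)
next
  case (Nar_T X t1 t2 S0 x)
  let ?S1 = "insert (IV x, [t1], [t2]) S0" and ?\<tau> = "single (HV X) [Susp 1 (IV x)] :: 'a subst"
  have fin: "finite S" using S by (rule store_okD)
  have new: "\<chi> \<noteq> HV X \<and> \<chi> \<noteq> IV x" if "(\<chi>, l, r) \<in> S0" for \<chi> l r
  proof -
    have "\<chi> \<noteq> HV X" using store_okD(2)[OF S, of \<chi> l r "[t1]" "[t2]"] that Nar_T by auto
    moreover have "\<chi> \<noteq> IV x"
      using Nar_T that by (auto simp: new_var_def vars_aups_def)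
    ultimately show ?thesis by simp
  qed
  then have new': "HV X \<notin> fst ` S0" "IV x \<notin> fst ` S0" by force+
  have "ctx_subst (sctx A \<Delta> S) ?\<tau> = sctx A \<Delta> ?S1"
  proof -
    have old: "(a, \<chi>) \<in> sctx A \<Delta> S \<and> \<chi> \<noteq> HV X \<longleftrightarrow> (a, \<chi>) \<in> sctx A \<Delta> S0" for a \<chi>
      unfolding in_sctx_iff Nar_T(1) using new by blast
    have nar: "(a, HV X) \<in> sctx A \<Delta> S \<longleftrightarrow> (a, IV x) \<in> store_ctx A \<Delta> (IV x) [t1] [t2]" for a
      unfolding in_sctx_iff Nar_T(1) store_ctx_def using new by blast
    have "ctx_subst (sctx A \<Delta> S) ?\<tau> = {(a, \<chi>) \<in> sctx A \<Delta> S. \<chi> \<noteq> HV X} \<union>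
        (\<lambda>(a, \<chi>). (a, IV x)) ` {(a, \<chi>) \<in> sctx A \<Delta> S. \<chi> = HV X}"
      using ctx_subst_single[OF finite_sctx[OF A fin], of \<Delta> "HV X" 1 "IV x"] by simp
    also have "{(a, \<chi>) \<in> sctx A \<Delta> S. \<chi> \<noteq> HV X} = sctx A \<Delta> S0"
      using old by auto
    also have "(\<lambda>(a, \<chi>). (a, IV x)) ` {(a, \<chi>) \<in> sctx A \<Delta> S. \<chi> = HV X} = store_ctx A \<Delta> (IV x) [t1] [t2]"
      using nar by (force simp: store_ctx_def)
    finally show ?thesis by (auto simp: sctx_insert)
  qed
  moreover have "store_ok ?S1"
  proof -
    have "inj_on fst ?S1" "finite ?S1" using S new' Nar_T(1) by (auto simp: store_ok_def)
    then show ?thesis using S Nar_T unfolding store_ok_def by auto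
  qed
  moreover have "store_size ?S1 < store_size S"
  proof -
    have fin0: "finite S0" using fin Nar_T(1) by simp
    have "card ?S1 = card S" using new' Nar_T(1,3) fin0 by (subst card_insert_disjoint) force+
    moreover have "{p \<in> ?S1. \<exists>X. fst p = HV X} = {p \<in> S0. \<exists>X. fst p = HV X}" by auto
    moreover have "card {p \<in> S0. \<exists>X. fst p = HV X} < card {p \<in> S. \<exists>X. fst p = HV X}"
      using fin Nar_T(1,3) by (intro psubset_card_mono) auto
    ultimately show ?thesis unfolding store_size_def by simp
  qed
  moreover have "hole_subst A \<Delta> S ?S1 ?\<tau>"
    using new'(1) unfolding hole_subst_def Nar_T(1)
    by (auto simp: single_def id_subst_def hole_refl) force
  ultimately show ?thesis
    using Nar_T(2) finite_dom_subst_upd[OF \<sigma>]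
    by (intro exI[of _ ?S1] exI[of _ ?\<tau>]) (auto simp: subst_upd_eq_comp)
qed auto

lemma terminal_saturated:
  assumes terminal: "\<not> (\<exists>st. vnau A \<Delta> ({}, S, \<Gamma>, \<sigma>) st)" and S: "store_ok S"
    and fin: "finite \<Delta>" "finite \<Gamma>" "finite (dom_subst \<sigma>)"
  shows "saturated A \<Delta> S"
proof -
  have narrowed: "\<not> (wf_iterm t1 \<and> wf_iterm t2)" if "(HV X, [t1], [t2]) \<in> S" for X t1 t2
  proof
    assume wf: "wf_iterm t1 \<and> wf_iterm t2"
    have "finite (vars_state ({}, S, \<Gamma>, \<sigma>) \<union> vars_ctx \<Delta>)"
      using fin store_okD(1)[OF S] by (simp add: finite_vars_state del: vars_state.simps) (simp add: vars_ctx_def)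
    then obtain x where "IV x \<notin> vars_state ({}, S, \<Gamma>, \<sigma>) \<union> vars_ctx \<Delta>" using ivar_avoiding by blast
    moreover have "S = insert (HV X, [t1], [t2]) (S - {(HV X, [t1], [t2])})" using that by auto
    ultimately show False
      using terminal vnau.Nar_T[of X t1 t2 "S - {(HV X, [t1], [t2])}" \<Delta> "{}" \<Gamma> \<sigma> x A] wf
      by (auto simp: new_var_def simp del: vars_state.simps)
  qed
  have "(\<chi>1, l1, r1) = (\<chi>2, l2, r2)"
    if mem: "(\<chi>1, l1, r1) \<in> S" "(\<chi>2, l2, r2) \<in> S" and \<pi>: "based_perm A \<pi>"
      and eq: "equiv_hedge \<Delta> (act_hedge \<pi> l1) l2" "equiv_hedge \<Delta> (act_hedge \<pi> r1) r2"
    for \<chi>1 l1 r1 \<chi>2 l2 r2 \<pi>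
  proof (rule ccontr)
    assume neq: "(\<chi>1, l1, r1) \<noteq> (\<chi>2, l2, r2)"
    \<comment> \<open>The restriction of \<open>Mer\<close> on kinds never blocks a merge here: if
      \<open>\<chi>2\<close> is an individual variable, its sides are individual terms, hence so are
      those of \<open>\<chi>1\<close>, and a narrowed store has no hedge variable there.\<close>
    have kind: "\<exists>y. \<chi>1 = IV y" if iv: "\<chi>2 = IV x" for x
    proof (rule ccontr)
      assume "\<not> (\<exists>y. \<chi>1 = IV y)"
      then obtain X where X: "\<chi>1 = HV X" by (cases \<chi>1) auto
      obtain t1 t2 where t: "l2 = [t1]" "r2 = [t2]" "wf_iterm t1" "wf_iterm t2"
        using store_okD(4)[OF S] mem(2) iv by blast
      obtain t1' where l: "l1 = [t1']" "equiv_elem \<Delta> (act \<pi> t1') t1" using eq(1) t(1) by (cases l1) auto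
      obtain t2' where r: "r1 = [t2']" "equiv_elem \<Delta> (act \<pi> t2') t2" using eq(2) t(2) by (cases r1) auto
      have "wf_iterm t1'" "wf_iterm t2'"
        using store_okD(3)[OF S mem(1)] is_hsusp_equiv[OF l(2)] is_hsusp_equiv[OF r(2)] t(3,4)
        by (auto simp: l r wf_iterm_def)
      then show False using narrowed mem(1) X l r by blast
    qed
    let ?S0 = "S - {(\<chi>1, l1, r1), (\<chi>2, l2, r2)}"
    have "S = {(\<chi>1, l1, r1), (\<chi>2, l2, r2)} \<union> ?S0" using mem by blast
    then show False
      using terminal vnau.Mer[of \<chi>1 l1 r1 \<chi>2 l2 r2 ?S0 A \<pi> \<Delta> "{}" \<Gamma> \<sigma>] neq kind \<pi> eq by auto
  qed
  then show ?thesis using narrowed S unfolding saturated_def by blast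
qed

section \<open>Problems with postconditions on the final state\<close>

type_synonym 'f goal = "'f hedge \<times> 'f hedge \<times> ('f aup set \<Rightarrow> 'f hedge \<Rightarrow> bool)"

definition aups :: "hvar list \<Rightarrow> 'f goal list \<Rightarrow> 'f aup set" where
  "aups Xs gs = set (map2 (\<lambda>X (s, q, \<Phi>). (HV X, s, q)) Xs gs)"

text \<open>Names outside the store ensure that instantiating the variable of an open problem leaves
  the stored variables alone.\<close>

definition start_ok :: "hvar list \<Rightarrow> 'f goal list \<Rightarrow> 'f aup set \<Rightarrow> 'f subst \<Rightarrow> bool" where
  "start_ok Xs gs S \<sigma> \<longleftrightarrow> length Xs = length gs \<and> distinct Xs \<and> (\<forall>X\<in>set Xs. HV X \<notin> fst ` S) \<and>
    (\<forall>(s, q, \<Phi>)\<in>set gs. wf_hedge s \<and> wf_hedge q) \<and> store_ok S \<and> finite (dom_subst \<sigma>)"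

definition meets :: "'f aup set \<Rightarrow> 'f subst \<Rightarrow> hvar list \<Rightarrow> 'f goal list \<Rightarrow> bool" where
  "meets S \<tau> Xs gs \<longleftrightarrow> list_all2 (\<lambda>X (s, q, \<Phi>). \<Phi> S (\<tau> (HV X))) Xs gs"

text \<open>
  \<open>attains A \<Delta> gs\<close>: the problems listed in \<open>gs\<close>, under any names and next to any store, can be
  run to a final state in which the instance of each problem's variable satisfies the
  postcondition \<open>\<Phi>\<close> of the problem. A postcondition may refer to the final store.
\<close>

definition attains :: "atom set \<Rightarrow> ctx \<Rightarrow> 'f goal list \<Rightarrow> bool" where
  "attains A \<Delta> gs \<longleftrightarrow> (\<forall>Xs S \<sigma>. start_ok Xs gs S \<sigma> \<longrightarrow> (\<exists>S' \<tau>. saturated A \<Delta> S' \<and>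
    (vnau A \<Delta>)\<^sup>*\<^sup>* (aups Xs gs, S, sctx A \<Delta> S, \<sigma>) ({}, S', sctx A \<Delta> S', comp_subst \<sigma> \<tau>) \<and>
    \<not> (\<exists>st. vnau A \<Delta> ({}, S', sctx A \<Delta> S', comp_subst \<sigma> \<tau>) st) \<and>
    meets S' \<tau> Xs gs \<and> hole_subst A \<Delta> S S' \<tau>))"

lemma aups_simps [simp]:
  "aups [] [] = {}"
  "aups (X # Xs) ((s, q, \<Phi>) # gs) = insert (HV X, s, q) (aups Xs gs)"
  by (simp_all add: aups_def)

lemma aups_append: "length Ys = length new \<Longrightarrow> aups (Ys @ Xs) (new @ gs) = aups Ys new \<union> aups Xs gs"
  by (simp add: aups_def)

lemma finite_aups [simp]: "finite (aups Xs gs)"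
  by (simp add: aups_def)

lemma in_aups: "(HV X, s, q) \<in> aups Xs gs \<Longrightarrow> X \<in> set Xs"
  by (auto simp: aups_def dest: set_zip_leftD)

lemma in_vars_aups: "length Xs = length gs \<Longrightarrow> X \<in> set Xs \<Longrightarrow> HV X \<in> vars_aups (aups Xs gs)"
  by (induction Xs gs rule: list_induct2) (auto simp: vars_aups_def)

lemma meets_cong:
  "(\<And>X. X \<in> set Xs \<Longrightarrow> \<tau> (HV X) = \<tau>' (HV X)) \<Longrightarrow> meets S \<tau> Xs gs \<longleftrightarrow> meets S \<tau>' Xs gs"
  unfolding meets_def by (rule list.rel_cong) auto

lemma meets_Cons [simp]:
  "meets S \<tau> (X # Xs) ((s, q, \<Phi>) # gs) \<longleftrightarrow> \<Phi> S (\<tau> (HV X)) \<and> meets S \<tau> Xs gs"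
  by (simp add: meets_def)

lemma meets_append:
  "length Ys = length new \<Longrightarrow> meets S \<tau> (Ys @ Xs) (new @ gs) \<longleftrightarrow> meets S \<tau> Ys new \<and> meets S \<tau> Xs gs"
  by (simp add: meets_def list_all2_append)

text \<open>With all problems solved, merging and narrowing run until no step applies.
  \<open>store_size\<close> bounds them, and the hole substitutions of the single steps
  compose.\<close>

lemma attains_Nil:
  assumes "finite A" "finite \<Delta>"
  shows "attains A \<Delta> []"
proof -
  have "\<exists>S' \<tau>. saturated A \<Delta> S' \<and>
      (vnau A \<Delta>)\<^sup>*\<^sup>* ({}, S, sctx A \<Delta> S, \<sigma>) ({}, S', sctx A \<Delta> S', comp_subst \<sigma> \<tau>) \<and>
      \<not> (\<exists>st. vnau A \<Delta> ({}, S', sctx A \<Delta> S', comp_subst \<sigma> \<tau>) st) \<and> hole_subst A \<Delta> S S' \<tau>"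
    if "store_ok S" "finite (dom_subst \<sigma>)" for S and \<sigma> :: "'a subst"
    using that
  proof (induction S arbitrary: \<sigma> rule: measure_induct_rule[of store_size])
    case (less S)
    show ?case
    proof (cases "\<exists>st. vnau A \<Delta> ({}, S, sctx A \<Delta> S, \<sigma>) st")
      case False
      then have "saturated A \<Delta> S"
        using terminal_saturated less.prems assms finite_sctx store_okD(1) by blast
      then show ?thesis
        using False by (intro exI[of _ S] exI[of _ id_subst]) (simp add: hole_subst_id)
    next
      case True
      then obtain S1 \<tau> where step: "vnau A \<Delta> ({}, S, sctx A \<Delta> S, \<sigma>) ({}, S1, sctx A \<Delta> S1, comp_subst \<sigma> \<tau>)"
        and S1: "store_ok S1" "store_size S1 < store_size S" "finite (dom_subst (comp_subst \<sigma> \<tau>))"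
          "hole_subst A \<Delta> S S1 \<tau>"
        using merge_step[OF _ less.prems(1) assms(1) less.prems(2)] by metis
      from less.IH[OF S1(2,1,3)] obtain S' \<tau>' where IH: "saturated A \<Delta> S'"
        "(vnau A \<Delta>)\<^sup>*\<^sup>* ({}, S1, sctx A \<Delta> S1, comp_subst \<sigma> \<tau>)
          ({}, S', sctx A \<Delta> S', comp_subst \<sigma> (comp_subst \<tau> \<tau>'))"
        "\<not> (\<exists>st. vnau A \<Delta> ({}, S', sctx A \<Delta> S', comp_subst \<sigma> (comp_subst \<tau> \<tau>')) st)"
        "hole_subst A \<Delta> S1 S' \<tau>'"
        unfolding comp_subst_assoc by blast
      show ?thesis
        using IH hole_subst_comp[OF S1(4) IH(4)] converse_rtranclp_into_rtranclp[OF step IH(2)] by blast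
    qed
  qed
  then show ?thesis by (auto simp: attains_def start_ok_def meets_def)
qed

lemma attains_weaken:
  assumes "attains A \<Delta> ((s, q, \<Phi>) # gs)" and "\<And>S v. \<Phi> S v \<Longrightarrow> \<Psi> S v"
  shows "attains A \<Delta> ((s, q, \<Psi>) # gs)"
  unfolding attains_def
proof (intro allI impI)
  fix Xs S and \<sigma> :: "'a subst"
  assume st: "start_ok Xs ((s, q, \<Psi>) # gs) S \<sigma>"
  then obtain X Xs' where Xs: "Xs = X # Xs'" by (cases Xs) (auto simp: start_ok_def)
  have "start_ok Xs ((s, q, \<Phi>) # gs) S \<sigma>" using st by (auto simp: start_ok_def)
  from assms(1)[unfolded attains_def, rule_format, OF this]
  show "\<exists>S' \<tau>. saturated A \<Delta> S' \<and>
    (vnau A \<Delta>)\<^sup>*\<^sup>* (aups Xs ((s, q, \<Psi>) # gs), S, sctx A \<Delta> S, \<sigma>) ({}, S', sctx A \<Delta> S', comp_subst \<sigma> \<tau>) \<and>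
    \<not> (\<exists>st. vnau A \<Delta> ({}, S', sctx A \<Delta> S', comp_subst \<sigma> \<tau>) st) \<and>
    meets S' \<tau> Xs ((s, q, \<Psi>) # gs) \<and> hole_subst A \<Delta> S S' \<tau>"
    using assms(2) by (auto simp: Xs)
qed

text \<open>One pattern for \<open>Tri_T\<close>, \<open>Tri_H\<close>, \<open>Dec_T\<close>,
  \<open>Dec_H\<close> and \<open>Abs_T\<close>: the problems in \<open>new\<close> replace the
  given one, and \<open>U\<close> builds the value of its variable from their variables
  \<open>Ys\<close>.\<close>

lemma attains_decompose:
  fixes U :: "hvar list \<Rightarrow> 'f hedge"
  assumes fin: "finite A" "finite \<Delta>"
    and new: "attains A \<Delta> (new @ gs)"
    and wf: "wf_hedge s \<Longrightarrow> wf_hedge q \<Longrightarrow> \<forall>(s, q, \<Phi>)\<in>set new. wf_hedge s \<and> wf_hedge q"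
    and step: "\<And>X Ys P S \<Gamma> \<sigma>. (HV X, s, q) \<notin> P \<Longrightarrow> length Ys = length new \<Longrightarrow> distinct Ys \<Longrightarrow>
      (\<And>Y. Y \<in> set Ys \<Longrightarrow> new_var \<Delta> (insert (HV X, s, q) P, S, \<Gamma>, \<sigma>) (HV Y)) \<Longrightarrow>
      vnau A \<Delta> (insert (HV X, s, q) P, S, \<Gamma>, \<sigma>)
        (aups Ys new \<union> P, S, \<Gamma>, subst_upd \<sigma> (HV X) (U Ys))"
    and post: "\<And>S \<tau> Ys. length Ys = length new \<Longrightarrow> meets S \<tau> Ys new \<Longrightarrow> \<Phi> S (subst_hedge \<tau> (U Ys))"
  shows "attains A \<Delta> ((s, q, \<Phi>) # gs)"
  unfolding attains_def
proof (intro allI impI)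
  fix Xs' S and \<sigma> :: "'f subst"
  assume st: "start_ok Xs' ((s, q, \<Phi>) # gs) S \<sigma>"
  then obtain X Xs where Xs': "Xs' = X # Xs" by (cases Xs') (auto simp: start_ok_def)
  have len: "length Xs = length gs" and dist: "X \<notin> set Xs" "distinct Xs"
    and dis: "\<forall>Y\<in>set (X # Xs). HV Y \<notin> fst ` S" and S: "store_ok S" and \<sigma>: "finite (dom_subst \<sigma>)"
    and wf': "wf_hedge s" "wf_hedge q" "\<forall>(s, q, \<Phi>)\<in>set gs. wf_hedge s \<and> wf_hedge q"
    using st by (auto simp: start_ok_def Xs')
  let ?st = "(insert (HV X, s, q) (aups Xs gs), S, sctx A \<Delta> S, \<sigma>)"
  have "finite (vars_state ?st \<union> vars_ctx \<Delta>)"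
    using finite_vars_state[OF _ store_okD(1)[OF S] finite_sctx[OF fin(1) store_okD(1)[OF S]] \<sigma>] fin(2)
    by (simp add: vars_ctx_def del: vars_state.simps)
  then obtain Ys where Ys: "length Ys = length new" "distinct Ys"
      "\<forall>Y\<in>set Ys. HV Y \<notin> vars_state ?st \<union> vars_ctx \<Delta>"
    using hvars_avoiding by blast
  have Y_Xs: "Y \<notin> set Xs" "HV Y \<notin> fst ` S" if "Y \<in> set Ys" for Y
  proof -
    show "Y \<notin> set Xs" using in_vars_aups[OF len] Ys(3) that by (fastforce simp: vars_aups_def)
    show "HV Y \<notin> fst ` S" using Ys(3) that by (force simp: vars_aups_def)
  qed
  then have Y_S: "\<forall>Y\<in>set Ys. HV Y \<notin> fst ` S" by blast
  let ?\<sigma> = "subst_upd \<sigma> (HV X) (U Ys)"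
  have step': "vnau A \<Delta> ?st (aups (Ys @ Xs) (new @ gs), S, sctx A \<Delta> S, ?\<sigma>)"
    unfolding aups_append[OF Ys(1)]
    using dist(1) Ys by (intro step) (auto simp: new_var_def simp del: vars_state.simps dest: in_aups)
  have "start_ok (Ys @ Xs) (new @ gs) S ?\<sigma>"
    using len dist dis S \<sigma> wf' wf Ys(1,2) Y_Xs(1) Y_S by (auto simp: start_ok_def finite_dom_subst_upd)
  from new[unfolded attains_def, rule_format, OF this] obtain S' \<tau> where
    S': "saturated A \<Delta> S'" and
    run: "(vnau A \<Delta>)\<^sup>*\<^sup>* (aups (Ys @ Xs) (new @ gs), S, sctx A \<Delta> S, ?\<sigma>) ({}, S', sctx A \<Delta> S', comp_subst ?\<sigma> \<tau>)" and
    final: "\<not> (\<exists>st. vnau A \<Delta> ({}, S', sctx A \<Delta> S', comp_subst ?\<sigma> \<tau>) st)" and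
    meets: "meets S' \<tau> Ys new" "meets S' \<tau> Xs gs" and holes: "hole_subst A \<Delta> S S' \<tau>"
    using meets_append[OF Ys(1)] by blast
  \<comment> \<open>Since \<open>X\<close> is neither in \<open>Xs\<close> nor a stored variable,
    putting its binding in front changes nothing for the other problems and the holes.\<close>
  let ?\<tau> = "comp_subst (single (HV X) (U Ys)) \<tau>"
  have eq: "comp_subst ?\<sigma> \<tau> = comp_subst \<sigma> ?\<tau>" by (simp add: subst_upd_eq_comp comp_subst_assoc)
  have "meets S' ?\<tau> Xs gs \<longleftrightarrow> meets S' \<tau> Xs gs"
    using dist(1) by (intro meets_cong) (auto simp: comp_single)
  then have "meets S' ?\<tau> Xs' ((s, q, \<Phi>) # gs)"
    using post[OF Ys(1) meets(1)] meets(2) by (simp add: Xs' comp_single)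
  moreover have "hole_subst A \<Delta> S S' ?\<tau>"
    unfolding hole_subst_def
  proof (intro allI impI)
    fix \<chi> l r assume "(\<chi>, l, r) \<in> S"
    moreover from this have "\<chi> \<noteq> HV X" using dis by force
    ultimately show "\<exists>\<pi> Z. ?\<tau> \<chi> = [Susp \<pi> Z] \<and> hole A \<Delta> S' \<pi> Z l r"
      using holes unfolding hole_subst_def by (simp add: comp_single)
  qed
  ultimately show "\<exists>S' \<tau>. saturated A \<Delta> S' \<and>
    (vnau A \<Delta>)\<^sup>*\<^sup>* (aups Xs' ((s, q, \<Phi>) # gs), S, sctx A \<Delta> S, \<sigma>) ({}, S', sctx A \<Delta> S', comp_subst \<sigma> \<tau>) \<and>
    \<not> (\<exists>st. vnau A \<Delta> ({}, S', sctx A \<Delta> S', comp_subst \<sigma> \<tau>) st) \<and>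
    meets S' \<tau> Xs' ((s, q, \<Phi>) # gs) \<and> hole_subst A \<Delta> S S' \<tau>"
    using S' converse_rtranclp_into_rtranclp[OF step' run] final unfolding eq
    by (intro exI[of _ S'] exI[of _ ?\<tau>]) (simp add: Xs')
qed

text \<open>The problem enters the store at once, so the hole substitution obtained for the enlarged
  store tells what its variable has become when merging ends.\<close>

lemma attains_solve:
  assumes gs: "attains A \<Delta> gs"
    and step: "\<And>X P S \<Gamma> \<sigma>. (HV X, s, q) \<notin> P \<Longrightarrow> vnau A \<Delta> (insert (HV X, s, q) P, S, \<Gamma>, \<sigma>)
      (P, insert (HV X, s, q) S, store_ctx A \<Delta> (HV X) s q \<union> \<Gamma>, \<sigma>)"
    and post: "\<And>S \<pi> Z. hole A \<Delta> S \<pi> Z s q \<Longrightarrow> \<Phi> S [Susp \<pi> Z]"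
  shows "attains A \<Delta> ((s, q, \<Phi>) # gs)"
  unfolding attains_def
proof (intro allI impI)
  fix Xs' S and \<sigma> :: "'a subst"
  assume st: "start_ok Xs' ((s, q, \<Phi>) # gs) S \<sigma>"
  then obtain X Xs where Xs': "Xs' = X # Xs" by (cases Xs') (auto simp: start_ok_def)
  have len: "length Xs = length gs" and dist: "X \<notin> set Xs" "distinct Xs"
    and dis: "\<forall>Y\<in>set (X # Xs). HV Y \<notin> fst ` S" and S: "store_ok S" and \<sigma>: "finite (dom_subst \<sigma>)"
    and wf': "wf_hedge s" "wf_hedge q" "\<forall>(s, q, \<Phi>)\<in>set gs. wf_hedge s \<and> wf_hedge q"
    using st by (auto simp: start_ok_def Xs')
  let ?S = "insert (HV X, s, q) S"
  have step': "vnau A \<Delta> (aups Xs' ((s, q, \<Phi>) # gs), S, sctx A \<Delta> S, \<sigma>) (aups Xs gs, ?S, sctx A \<Delta> ?S, \<sigma>)"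
    unfolding Xs' aups_simps sctx_insert using dist(1) by (intro step) (blast dest: in_aups)
  have "store_ok ?S" using S wf' dis by (auto simp: store_ok_def)
  then have "start_ok Xs gs ?S \<sigma>"
    using len dist dis \<sigma> wf' by (auto simp: start_ok_def)
  from gs[unfolded attains_def, rule_format, OF this] obtain S' \<tau> where
    S': "saturated A \<Delta> S'" and
    run: "(vnau A \<Delta>)\<^sup>*\<^sup>* (aups Xs gs, ?S, sctx A \<Delta> ?S, \<sigma>) ({}, S', sctx A \<Delta> S', comp_subst \<sigma> \<tau>)" and
    final: "\<not> (\<exists>st. vnau A \<Delta> ({}, S', sctx A \<Delta> S', comp_subst \<sigma> \<tau>) st)" and
    meets: "meets S' \<tau> Xs gs" and holes: "hole_subst A \<Delta> ?S S' \<tau>"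
    by blast
  obtain \<pi> Z where "\<tau> (HV X) = [Susp \<pi> Z]" "hole A \<Delta> S' \<pi> Z s q"
    using holes unfolding hole_subst_def by blast
  then have "meets S' \<tau> Xs' ((s, q, \<Phi>) # gs)"
    using meets post by (simp add: Xs')
  moreover have "hole_subst A \<Delta> S S' \<tau>"
    using holes unfolding hole_subst_def by blast
  ultimately show "\<exists>S' \<tau>. saturated A \<Delta> S' \<and>
    (vnau A \<Delta>)\<^sup>*\<^sup>* (aups Xs' ((s, q, \<Phi>) # gs), S, sctx A \<Delta> S, \<sigma>) ({}, S', sctx A \<Delta> S', comp_subst \<sigma> \<tau>) \<and>
    \<not> (\<exists>st. vnau A \<Delta> ({}, S', sctx A \<Delta> S', comp_subst \<sigma> \<tau>) st) \<and>
    meets S' \<tau> Xs' ((s, q, \<Phi>) # gs) \<and> hole_subst A \<Delta> S S' \<tau>"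
    using S' converse_rtranclp_into_rtranclp[OF step' run] final by blast
qed

section \<open>Following the generalization\<close>

text \<open>
  The second conjunct is for a remainder that is empty on both sides: \<open>Dec_H\<close> does not split it
  off, so that no problem, and no variable, is created for it.
\<close>

definition plan :: "atom set \<Rightarrow> ctx \<Rightarrow> 'f hedge \<Rightarrow> 'f hedge \<Rightarrow> ('f aup set \<Rightarrow> 'f hedge \<Rightarrow> bool) \<Rightarrow> bool" where
  "plan A \<Delta> s q \<Phi> \<longleftrightarrow> (\<forall>gs. attains A \<Delta> gs \<longrightarrow> attains A \<Delta> ((s, q, \<Phi>) # gs)) \<and>
    (s = [] \<longrightarrow> q = [] \<longrightarrow> (\<forall>S. \<Phi> S []))"

lemma plan_weaken: "plan A \<Delta> s q \<Phi> \<Longrightarrow> (\<And>S v. \<Phi> S v \<Longrightarrow> \<Psi> S v) \<Longrightarrow> plan A \<Delta> s q \<Psi>"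
  unfolding plan_def using attains_weaken[of A \<Delta> s q \<Phi> _ \<Psi>] by blast

context
  fixes A :: "atom set" and \<Delta> :: ctx
  assumes fin: "finite A" "finite \<Delta>"
begin

section \<open>Plans for single rules and their combination\<close>

lemma plan_Nil: "(\<And>S. \<Phi> S []) \<Longrightarrow> plan A \<Delta> [] [] \<Phi>"
  unfolding plan_def
  by (auto intro!: attains_decompose[OF fin, where new = "[]" and U = "\<lambda>_. []"] vnau.Tri_H)

lemma plan_Atom: "(\<And>S. \<Phi> S [Atom a]) \<Longrightarrow> plan A \<Delta> [Atom a] [Atom a] \<Phi>"
  unfolding plan_def
  by (auto intro!: attains_decompose[OF fin, where new = "[]" and U = "\<lambda>_. [Atom a]"] vnau.Tri_T)

lemma plan_Fun:
  assumes "plan A \<Delta> s q \<Phi>" and "\<And>S w. \<Phi> S w \<Longrightarrow> \<Psi> S [Fun f w]"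
  shows "plan A \<Delta> [Fun f s] [Fun f q] \<Psi>"
proof -
  have "attains A \<Delta> (([Fun f s], [Fun f q], \<Psi>) # gs)" if "attains A \<Delta> gs" for gs
  proof (rule attains_decompose[OF fin, where new = "[(s, q, \<Phi>)]" and U = "\<lambda>Ys. [Fun f [Susp 1 (HV (hd Ys))]]"])
    show "attains A \<Delta> ([(s, q, \<Phi>)] @ gs)" using assms(1) that by (simp add: plan_def)
  qed (auto simp: length_Suc_conv intro!: vnau.Dec_T assms(2))
  then show ?thesis by (simp add: plan_def)
qed

lemma plan_Abs:
  assumes "plan A \<Delta> (act_hedge \<langle>c \<leftrightarrow> a\<rangle> s) (act_hedge \<langle>c \<leftrightarrow> b\<rangle> q) \<Phi>"
    and "abs_atom A \<Delta> (Abs a s) (Abs b q) c" and "\<And>S w. \<Phi> S w \<Longrightarrow> \<Psi> S [Abs c w]"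
  shows "plan A \<Delta> [Abs a s] [Abs b q] \<Psi>"
proof -
  have "attains A \<Delta> (([Abs a s], [Abs b q], \<Psi>) # gs)" if "attains A \<Delta> gs" for gs
  proof (rule attains_decompose[OF fin,
        where new = "[(act_hedge \<langle>c \<leftrightarrow> a\<rangle> s, act_hedge \<langle>c \<leftrightarrow> b\<rangle> q, \<Phi>)]"
          and U = "\<lambda>Ys. [Abs c [Susp 1 (HV (hd Ys))]]"])
    show "attains A \<Delta> ([(act_hedge \<langle>c \<leftrightarrow> a\<rangle> s, act_hedge \<langle>c \<leftrightarrow> b\<rangle> q, \<Phi>)] @ gs)"
      using assms(1) that by (simp add: plan_def)
  qed (auto simp: length_Suc_conv wf_iterm_def intro!: vnau.Abs_T assms(2,3))
  then show ?thesis by (simp add: plan_def)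
qed

lemma plan_hole:
  assumes "length (s @ q) = 1 \<or> (\<exists>t1 t2. s = [t1] \<and> q = [t2] \<and> stuck A \<Delta> t1 t2)"
    and "\<And>S \<pi> Z. hole A \<Delta> S \<pi> Z s q \<Longrightarrow> \<Phi> S [Susp \<pi> Z]"
  shows "plan A \<Delta> s q \<Phi>"
proof -
  have "attains A \<Delta> ((s, q, \<Phi>) # gs)" if "attains A \<Delta> gs" for gs
    using that
  proof (rule attains_solve)
    fix X and P S :: "'a aup set" and \<Gamma> \<sigma>
    assume new: "(HV X, s, q) \<notin> P"
    show "vnau A \<Delta> (insert (HV X, s, q) P, S, \<Gamma>, \<sigma>)
      (P, insert (HV X, s, q) S, store_ctx A \<Delta> (HV X) s q \<union> \<Gamma>, \<sigma>)"
    proof (cases "length (s @ q) = 1")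
      case True
      then show ?thesis using new by (intro vnau.Sol_H)
    next
      case False
      then obtain t1 t2 where t: "s = [t1]" "q = [t2]" and st: "stuck A \<Delta> t1 t2" using assms(1) by blast
      show ?thesis
      proof (cases "is_susp t1 \<and> is_susp t2 \<or> head t1 \<noteq> head t2")
        case True
        then show ?thesis using new unfolding t by (intro vnau.Sol_T)
      next
        case False
        then obtain a u b w where "t1 = Abs a u" "t2 = Abs b w"
          using st unfolding stuck_def by (cases t1; cases t2) auto
        then show ?thesis using new st False unfolding t stuck_def by (auto intro: vnau.Sol_T_Abs)
      qed
    qed
  qed (rule assms(2))
  then show ?thesis using assms(1) by (auto simp: plan_def)
qed

text \<open>\<open>Dec_H\<close> splits off a single position and demands a nonempty remainder.
  Without one, the front problem is already the whole problem, and the second postcondition is used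
  for the empty hedge.\<close>

lemma plan_append:
  assumes 1: "plan A \<Delta> s1 q1 \<Phi>1" and 2: "plan A \<Delta> s2 q2 \<Phi>2"
    and len: "length (s1 @ q1) = 1 \<or> length s1 = 1 \<and> length q1 = 1"
    and post: "\<And>S v1 v2. \<Phi>1 S v1 \<Longrightarrow> \<Phi>2 S v2 \<Longrightarrow> \<Psi> S (v1 @ v2)"
  shows "plan A \<Delta> (s1 @ s2) (q1 @ q2) \<Psi>"
proof (cases "s2 = [] \<and> q2 = []")
  case True
  then have "\<Phi>2 S []" for S using 2 by (simp add: plan_def)
  then show ?thesis using True plan_weaken[OF 1, of \<Psi>] post[of _ _ "[]"] by simp
next
  case False
  then have len2: "length (s2 @ q2) \<ge> 1" by (cases s2; cases q2) auto
  have "attains A \<Delta> ((s1 @ s2, q1 @ q2, \<Psi>) # gs)" if "attains A \<Delta> gs" for gs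
  proof (rule attains_decompose[OF fin, where new = "[(s1, q1, \<Phi>1), (s2, q2, \<Phi>2)]"
        and U = "\<lambda>Ys. [Susp 1 (HV (Ys ! 0)), Susp 1 (HV (Ys ! 1))]"])
    show "attains A \<Delta> ([(s1, q1, \<Phi>1), (s2, q2, \<Phi>2)] @ gs)"
      using 1 2 that by (simp add: plan_def)
  next
    fix X Ys and P S :: "'a aup set" and \<Gamma> \<sigma>
    assume new: "(HV X, s1 @ s2, q1 @ q2) \<notin> P"
      and Ys: "length Ys = length [(s1, q1, \<Phi>1), (s2, q2, \<Phi>2)]" "distinct Ys"
        "\<And>Y. Y \<in> set Ys \<Longrightarrow> new_var \<Delta> (insert (HV X, s1 @ s2, q1 @ q2) P, S, \<Gamma>, \<sigma>) (HV Y)"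
    obtain Y1 Y2 where Y: "Ys = [Y1, Y2]" using Ys(1) by (auto simp: length_Suc_conv)
    show "vnau A \<Delta> (insert (HV X, s1 @ s2, q1 @ q2) P, S, \<Gamma>, \<sigma>)
      (aups Ys [(s1, q1, \<Phi>1), (s2, q2, \<Phi>2)] \<union> P, S, \<Gamma>,
       subst_upd \<sigma> (HV X) [Susp 1 (HV (Ys ! 0)), Susp 1 (HV (Ys ! 1))])"
      using vnau.Dec_H[OF new len len2 Ys(3) Ys(3), of Y1 Y2] Ys(2) by (simp add: Y)
  qed (auto simp: length_Suc_conv post)
  then show ?thesis using len by (auto simp: plan_def)
qed

lemma size_act_hedge [simp]: "size_list size (act_hedge \<pi> s) = size_list size s"
  by (induction s rule: hedge_induct) simp_all

lemma cdec_append: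
  "cdec A \<Delta> S w [t1] [t2] \<Longrightarrow> cdec A \<Delta> S v s q \<Longrightarrow> cdec A \<Delta> S (w @ v) (t1 # s) (t2 # q)"
  "cdec A \<Delta> S w [t1] [] \<Longrightarrow> cdec A \<Delta> S v s [] \<Longrightarrow> cdec A \<Delta> S (w @ v) (t1 # s) []"
  "cdec A \<Delta> S w [] [t2] \<Longrightarrow> cdec A \<Delta> S v [] q \<Longrightarrow> cdec A \<Delta> S (w @ v) [] (t2 # q)"
  by (auto elim!: cdec_Cons_ConsE cdec_Cons_NilE cdec_Nil_ConsE cdec_Nil_NilE intro: cdec.intros)

text \<open>\<open>Dec_H\<close> cuts off one position at a time and cannot cut between the instance
  of a variable and what follows. So \<open>s\<close> and \<open>q\<close> are decomposed with the
  tails \<open>s2\<close> and \<open>q2\<close> carried along; surplus positions of the longer side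
  are split off against the empty hedge before the tails are reached.\<close>

lemma plan_cdec_append:
  fixes s q s2 q2 :: "'a hedge"
  assumes "plan A \<Delta> s2 q2 \<Phi>" and "\<And>S w v. cdec A \<Delta> S w s q \<Longrightarrow> \<Phi> S v \<Longrightarrow> \<Psi> S (w @ v)"
  shows "plan A \<Delta> (s @ s2) (q @ q2) \<Psi>"
  using assms
proof (induction "size_list size s + size_list size q" arbitrary: s q s2 q2 \<Phi> \<Psi> rule: less_induct)
  case less
  \<comment> \<open>Bodies below \<open>Abs\<close> and \<open>Fun\<close> are decomposed on their
    own, which is the case of empty tails.\<close>
  have IH: "plan A \<Delta> s' q' (\<lambda>S w. cdec A \<Delta> S w s' q')"
    if "size_list size s' + size_list size q' < size_list size s + size_list size q" for s' q' :: "'a hedge"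
  proof -
    have "plan A \<Delta> [] [] (\<lambda>(S :: 'a aup set) v. v = [])" by (rule plan_Nil) simp
    from less.hyps[OF that this, of "\<lambda>S w. cdec A \<Delta> S w s' q'"] show ?thesis by simp
  qed
  have elem: "plan A \<Delta> [t1] [t2] (\<lambda>S w. cdec A \<Delta> S w [t1] [t2])"
    if st: "s = t1 # s'" "q = t2 # q'" for t1 t2 s' q'
  proof (cases "stuck A \<Delta> t1 t2")
    case True
    then show ?thesis by (intro plan_hole) (auto intro: cdec.intros)
  next
    case False
    then have head: "head t1 = head t2" by (auto simp: stuck_def)
    show ?thesis
    proof (cases t1)
      case (Atom a)
      then show ?thesis using head by (cases t2) (auto intro: plan_Atom cdec.intros)
    next
      case (Susp \<pi> \<chi>)
      then show ?thesis using head False by (cases t2) (auto simp: stuck_def)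
    next
      case (Abs a u)
      then obtain b w where t2: "t2 = Abs b w" using head by (cases t2) auto
      then obtain c where c: "abs_atom A \<Delta> (Abs a u) (Abs b w) c"
        using False Abs by (auto simp: stuck_def)
      have "plan A \<Delta> (act_hedge \<langle>c \<leftrightarrow> a\<rangle> u) (act_hedge \<langle>c \<leftrightarrow> b\<rangle> w)
          (\<lambda>S v. cdec A \<Delta> S v (act_hedge \<langle>c \<leftrightarrow> a\<rangle> u) (act_hedge \<langle>c \<leftrightarrow> b\<rangle> w))"
        by (rule IH) (simp add: st Abs t2)
      then show ?thesis using c unfolding Abs t2 by (rule plan_Abs) (auto intro: cdec.intros c)
    next
      case (Fun f u)
      then obtain w where t2: "t2 = Fun f w" using head by (cases t2) auto
      have "plan A \<Delta> u w (\<lambda>S v. cdec A \<Delta> S v u w)"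
        by (rule IH) (simp add: st Fun t2)
      then show ?thesis unfolding Fun t2 by (rule plan_Fun) (auto intro: cdec.intros)
    qed
  qed
  have step: "plan A \<Delta> (s @ s2) (q @ q2) \<Psi>"
    if st: "s = s0 @ s'" "q = q0 @ q'" and pl: "plan A \<Delta> s0 q0 (\<lambda>S w. cdec A \<Delta> S w s0 q0)"
      and len: "length (s0 @ q0) = 1 \<or> length s0 = 1 \<and> length q0 = 1"
      and app: "\<And>S w v. cdec A \<Delta> S w s0 q0 \<Longrightarrow> cdec A \<Delta> S v s' q' \<Longrightarrow> cdec A \<Delta> S (w @ v) s q"
    for s0 s' q0 q'
  proof -
    have "size_list size s' + size_list size q' < size_list size s + size_list size q"
      using len by (cases s0; cases q0) (auto simp: st)
    \<comment> \<open>The postcondition for the rest remembers where the decomposition of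
      \<open>s'\<close> and \<open>q'\<close> ends and that of the tails begins.\<close>
    then have "plan A \<Delta> (s' @ s2) (q' @ q2) (\<lambda>S v. \<exists>w v'. v = w @ v' \<and> cdec A \<Delta> S w s' q' \<and> \<Phi> S v')"
      using less.prems(1) by (rule less.hyps) blast
    from plan_append[OF pl this len, of \<Psi>] show ?thesis
      using app less.prems(2) by (fastforce simp: st)
  qed
  show ?case
  proof (cases s)
    case Nil
    show ?thesis
    proof (cases q)
      case Nil
      have "plan A \<Delta> s2 q2 \<Psi>"
        by (rule plan_weaken[OF less.prems(1)])
          (use less.prems(2)[of _ "[]"] in \<open>simp add: \<open>s = []\<close> \<open>q = []\<close> cdec.cdec_Nil\<close>)
      then show ?thesis using \<open>s = []\<close> Nil by simp
    next
      case (Cons t q')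
      have "plan A \<Delta> [] [t] (\<lambda>S w. cdec A \<Delta> S w [] [t])"
        by (rule plan_hole) (auto intro: cdec.intros)
      then show ?thesis
        by (intro step[of "[]" "[]" "[t]" q']) (simp_all add: \<open>s = []\<close> Cons cdec_append(3))
    qed
  next
    case (Cons t1 s')
    show ?thesis
    proof (cases q)
      case Nil
      have "plan A \<Delta> [t1] [] (\<lambda>S w. cdec A \<Delta> S w [t1] [])"
        by (rule plan_hole) (auto intro: cdec.intros)
      then show ?thesis
        by (intro step[of "[t1]" s' "[]" "[]"]) (simp_all add: \<open>s = t1 # s'\<close> Nil cdec_append(2))
    next
      case (Cons t2 q')
      then show ?thesis
        using elem[OF \<open>s = t1 # s'\<close> Cons]
        by (intro step[of "[t1]" s' "[t2]" q']) (simp_all add: \<open>s = t1 # s'\<close> cdec_append(1))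
    qed
  qed
qed

text \<open>Atoms and function symbols of \<open>u\<close> force the same ones on both sides, and a
  bound atom of \<open>u\<close> is admissible for \<open>Abs_T\<close>: it lies in \<open>A\<close>
  and, by equivalence with the instances of \<open>u\<close>, is fresh for both abstractions. At a
  suspension \<open>plan_cdec_append\<close> takes over, with the rest of \<open>u\<close> supplying
  the tails.\<close>

lemma plan_gdec:
  assumes "equiv_hedge \<Delta> (subst_hedge \<sigma>1 u) s" and "equiv_hedge \<Delta> (subst_hedge \<sigma>2 u) q"
    and "atoms_hedge u \<subseteq> A" and "wf_hedge s" and "wf_hedge q"
  shows "plan A \<Delta> s q (\<lambda>S v. gdec A \<Delta> S \<sigma>1 \<sigma>2 u v s q)"
  using assms
proof (induction u arbitrary: s q rule: hedge_induct)
  case Nil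
  then show ?case by (auto intro: plan_Nil gdec.intros)
next
  case (Atom a u)
  from Atom.prems obtain s' q' where sq: "s = [Atom a] @ s'" "q = [Atom a] @ q'" and
    eq: "equiv_hedge \<Delta> (subst_hedge \<sigma>1 u) s'" "equiv_hedge \<Delta> (subst_hedge \<sigma>2 u) q'"
    by (auto simp: equiv_hedge_Cons1)
  have "plan A \<Delta> [Atom a] [Atom a] (\<lambda>S v. v = [Atom a])" by (rule plan_Atom) simp
  then show ?case
    unfolding sq by (rule plan_append[OF _ Atom.IH[OF eq]]) (use Atom.prems sq in \<open>auto intro: gdec.intros\<close>)
next
  case (Susp \<pi> \<chi> u)
  from Susp.prems(1) obtain s0 s' where s: "s = s0 @ s'" "equiv_hedge \<Delta> (act_hedge \<pi> (\<sigma>1 \<chi>)) s0"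
      "equiv_hedge \<Delta> (subst_hedge \<sigma>1 u) s'"
    by (auto simp: equiv_hedge_append1)
  from Susp.prems(2) obtain q0 q' where q: "q = q0 @ q'" "equiv_hedge \<Delta> (act_hedge \<pi> (\<sigma>2 \<chi>)) q0"
      "equiv_hedge \<Delta> (subst_hedge \<sigma>2 u) q'"
    by (auto simp: equiv_hedge_append1)
  have "plan A \<Delta> s' q' (\<lambda>S v. gdec A \<Delta> S \<sigma>1 \<sigma>2 u v s' q')"
    using Susp.prems s q by (intro Susp.IH) auto
  then show ?case
    unfolding s(1) q(1)
    by (rule plan_cdec_append)
      (use Susp.prems s q in \<open>auto intro!: gdec.gdec_Susp simp: based_perm_def\<close>)
next
  case (Abs c u1 u)
  from Abs.prems(1) obtain a s1 s' where s: "s = [Abs a s1] @ s'"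
      "equiv_elem \<Delta> (Abs c (subst_hedge \<sigma>1 u1)) (Abs a s1)" "equiv_hedge \<Delta> (subst_hedge \<sigma>1 u) s'"
    by (auto simp: equiv_hedge_Cons1) (auto simp: equiv_Abs_iff)
  from Abs.prems(2) obtain b q1 q' where q: "q = [Abs b q1] @ q'"
      "equiv_elem \<Delta> (Abs c (subst_hedge \<sigma>2 u1)) (Abs b q1)" "equiv_hedge \<Delta> (subst_hedge \<sigma>2 u) q'"
    by (auto simp: equiv_hedge_Cons1) (auto simp: equiv_Abs_iff)
  have c: "abs_atom A \<Delta> (Abs a s1) (Abs b q1) c"
    using s(2) q(2) Abs.prems(3) by (auto simp: equiv_Abs_iff abs_atom_def)
  have "plan A \<Delta> (act_hedge \<langle>c \<leftrightarrow> a\<rangle> s1) (act_hedge \<langle>c \<leftrightarrow> b\<rangle> q1)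
      (\<lambda>S v. gdec A \<Delta> S \<sigma>1 \<sigma>2 u1 v (act_hedge \<langle>c \<leftrightarrow> a\<rangle> s1) (act_hedge \<langle>c \<leftrightarrow> b\<rangle> q1))"
    using s q Abs.prems by (intro Abs.IH(1)) (auto simp: equiv_Abs_iff wf_iterm_def)
  then have 1: "plan A \<Delta> [Abs a s1] [Abs b q1] (\<lambda>S v. \<exists>w. v = [Abs c w] \<and>
      gdec A \<Delta> S \<sigma>1 \<sigma>2 u1 w (act_hedge \<langle>c \<leftrightarrow> a\<rangle> s1) (act_hedge \<langle>c \<leftrightarrow> b\<rangle> q1))"
    using c by (rule plan_Abs) simp
  have 2: "plan A \<Delta> s' q' (\<lambda>S v. gdec A \<Delta> S \<sigma>1 \<sigma>2 u v s' q')"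
    using Abs.prems s q by (intro Abs.IH(2)) auto
  show ?case unfolding s(1) q(1) by (rule plan_append[OF 1 2]) (auto intro: gdec.intros)
next
  case (Fun f u1 u)
  from Fun.prems(1) obtain s1 s' where s: "s = [Fun f s1] @ s'"
      "equiv_hedge \<Delta> (subst_hedge \<sigma>1 u1) s1" "equiv_hedge \<Delta> (subst_hedge \<sigma>1 u) s'"
    by (auto simp: equiv_hedge_Cons1 equiv_Fun_iff)
  from Fun.prems(2) obtain q1 q' where q: "q = [Fun f q1] @ q'"
      "equiv_hedge \<Delta> (subst_hedge \<sigma>2 u1) q1" "equiv_hedge \<Delta> (subst_hedge \<sigma>2 u) q'"
    by (auto simp: equiv_hedge_Cons1 equiv_Fun_iff)
  have "plan A \<Delta> s1 q1 (\<lambda>S v. gdec A \<Delta> S \<sigma>1 \<sigma>2 u1 v s1 q1)"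
    using s q Fun.prems by (intro Fun.IH(1)) auto
  then have 1: "plan A \<Delta> [Fun f s1] [Fun f q1]
      (\<lambda>S v. \<exists>w. v = [Fun f w] \<and> gdec A \<Delta> S \<sigma>1 \<sigma>2 u1 w s1 q1)"
    by (rule plan_Fun) simp
  have 2: "plan A \<Delta> s' q' (\<lambda>S v. gdec A \<Delta> S \<sigma>1 \<sigma>2 u v s' q')"
    using Fun.prems s q by (intro Fun.IH(2)) auto
  show ?case unfolding s(1) q(1) by (rule plan_append[OF 1 2]) (auto intro: gdec.intros)
qed

end

theorem theorem3:
  fixes A :: "atom set" and l r :: "'f::countable hedge" and \<Delta> :: ctx and X :: hvar
    and G :: "'f tic"
  assumes "finite A"
    and "wf_hedge l" and "wf_hedge r" and "finite \<Delta>"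
    and "based_hedge A l" and "based_hedge A r" and "based_ctx A \<Delta>"
    and "HV X \<notin> vars_hedge l \<union> vars_hedge r \<union> vars_ctx \<Delta>"
    and "generalization G (\<Delta>, l) (\<Delta>, r)" and "based_tic A G"
  shows "\<exists>S \<Gamma> \<sigma>. vnau_execution A \<Delta> ({(HV X, l, r)}, {}, {}, id_subst) ({}, S, \<Gamma>, \<sigma>) \<and>
           more_general G (\<Gamma>, \<sigma> (HV X))"
proof -
  obtain \<Xi> u where G: "G = (\<Xi>, u)" by (cases G)
  have \<Xi>: "finite \<Xi>" "based_ctx A \<Xi>" and u: "atoms_hedge u \<subseteq> A"
    and mg: "more_general (\<Xi>, u) (\<Delta>, l)" "more_general (\<Xi>, u) (\<Delta>, r)"
    using assms(9,10) by (auto simp: G generalization_def is_tic_def based_tic_def based_hedge_def)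
  obtain \<sigma>1 where \<sigma>1: "is_subst \<sigma>1" "\<And>a \<chi>. (a, \<chi>) \<in> \<Xi> \<Longrightarrow> fresh_hedge \<Delta> a (\<sigma>1 \<chi>)"
      "equiv_hedge \<Delta> (subst_hedge \<sigma>1 u) l"
    using mg(1) unfolding more_general_iff[OF assms(4)] by blast
  obtain \<sigma>2 where \<sigma>2: "is_subst \<sigma>2" "\<And>a \<chi>. (a, \<chi>) \<in> \<Xi> \<Longrightarrow> fresh_hedge \<Delta> a (\<sigma>2 \<chi>)"
      "equiv_hedge \<Delta> (subst_hedge \<sigma>2 u) r"
    using mg(2) unfolding more_general_iff[OF assms(4)] by blast
  let ?gs = "[(l, r, \<lambda>S v. gdec A \<Delta> S \<sigma>1 \<sigma>2 u v l r)]"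
  have "attains A \<Delta> ?gs"
    using plan_gdec[OF assms(1,4) \<sigma>1(3) \<sigma>2(3) u assms(2,3)]
    by (simp add: plan_def attains_Nil[OF assms(1,4)])
  moreover have "start_ok [X] ?gs {} id_subst"
    using assms(2,3) by (simp add: start_ok_def store_ok_def dom_subst_def id_subst_def)
  ultimately obtain S \<sigma> where S: "saturated A \<Delta> S"
    and run: "(vnau A \<Delta>)\<^sup>*\<^sup>* ({(HV X, l, r)}, {}, {}, id_subst) ({}, S, sctx A \<Delta> S, \<sigma>)"
    and final: "\<not> (\<exists>st. vnau A \<Delta> ({}, S, sctx A \<Delta> S, \<sigma>) st)"
    and dec: "gdec A \<Delta> S \<sigma>1 \<sigma>2 u (\<sigma> (HV X)) l r"
    unfolding attains_def by (fastforce simp: meets_def)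
  \<comment> \<open>At least one step is made, because the initial state has a problem left and the
    final one has none.\<close>
  have "(vnau A \<Delta>)\<^sup>+\<^sup>+ ({(HV X, l, r)}, {}, {}, id_subst) ({}, S, sctx A \<Delta> S, \<sigma>)"
    using run by (auto dest: rtranclpD)
  then have "vnau_execution A \<Delta> ({(HV X, l, r)}, {}, {}, id_subst) ({}, S, sctx A \<Delta> S, \<sigma>)"
    using final by (simp add: vnau_execution_def)
  moreover have "more_general G (sctx A \<Delta> S, \<sigma> (HV X))"
    unfolding G using more_general_gdec[OF assms(1) S dec \<Xi> \<sigma>1(1) \<sigma>2(1) \<sigma>1(2) \<sigma>2(2)] .
  ultimately show ?thesis by blast
qed

end
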